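(* For $m\ge2$ let $P_2(m)$ be the almost sure limit, as $n\to\infty$, of the fraction of nodes of the random $m$-ary search tree $T_n$ with $n$ keys that are $2$-protected. Then, as $m\to\infty$, $$P_2(m)=\frac{2}{m^3}+O\bigl(m^{-4}\bigr).$$
   Context: $m$-ary search tree: each node holds up to $m-1$ keys (distinct reals). Start with an empty root. The first $m-1$ keys are stored in the root; when the root becomes full, $m$ new empty nodes are added as its children $1,\dots,m$. The $m-1$ keys divide $\mathbb R$ into intervals $J_1,\dots,J_m$; each further key lying in $J_i$ is passed to child $i$, where the same rule is applied recursively. Finally all empty nodes are deleted; the $m$-ary search tree consists of the nodes containing at least one key. $T_n$ is the tree built from the first $n$ terms of an i.i.d. sequence of keys with a continuous distribution. A node in a rooted tree is 2-protected iff it is not a leaf and has no child that is a leaf. The almost sure limit $P_2(m)$ exists and is a constant; explicitly $P_2(m)=\frac{2}{m}\sum_{\ell=0}^{m-1}\frac{m!}{(m-\ell)!}\cdot\frac{(m(m-\ell))!}{(m(m-\ell)+\ell+1)!}$. *)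

theory Defs
  imports "HOL-Probability.Probability" "HOL-Library.Landau_Symbols"
begin

text \<open>
  A node is identified with the fringe subtree hanging from it; it carries the list of its keys
  and the list of its children, from left to right.
\<close>

datatype mtree = Node (keys: "real list") (children: "mtree list")

text \<open>
  Insertion of a key \<open>x\<close> into a tree that may still contain empty nodes. As soon as a node holds
  \<open>m - 1\<close> keys it gets \<open>m\<close> empty children. In a full node, \<open>i\<close> is the number of keys less than \<open>x\<close>,
  i.e. the 0-based index of the interval (and of the child) that \<open>x\<close> belongs to. The guard
  \<open>i < length ts\<close> always holds when \<open>m \<ge> 2\<close> and the tree is built from an empty root.
\<close>

function insert_key :: "nat \<Rightarrow> real \<Rightarrow> mtree \<Rightarrow> mtree" where
  "insert_key m x (Node ks ts) =
     (if length ks < m - 1 then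
        Node (ks @ [x])
          (if Suc (length ks) = m - 1 then replicate m (Node [] []) else [])
      else
        (let i = length (filter (\<lambda>k. k < x) ks) in
         if i < length ts then Node ks (ts[i := insert_key m x (ts ! i)]) else Node ks ts))"
  by pat_completeness auto

termination
proof (relation "Wellfounded.measure (\<lambda>(m, x, t). size t)", goal_cases)
  case 1
  show ?case by simp
next
  case (2 m x ks ts i)
  have "size (ts ! i) \<le> size_list size ts"
    using 2 by (intro size_list_estimation') auto
  then show ?case by simp
qed

primrec delete_empty :: "mtree \<Rightarrow> mtree" where
  "delete_empty (Node ks ts) =
     Node ks (map snd (filter (\<lambda>(t, t'). keys t \<noteq> []) (map (\<lambda>t. (t, delete_empty t)) ts)))"

text \<open>
  The root is never deleted, so for no keys at all the
  result is a single empty node.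
\<close>

definition search_tree :: "nat \<Rightarrow> real list \<Rightarrow> mtree" where
  "search_tree m xs = delete_empty (fold (insert_key m) xs (Node [] []))"

primrec nodes :: "mtree \<Rightarrow> mtree list" where
  "nodes (Node ks ts) = Node ks ts # concat (map nodes ts)"

definition is_leaf :: "mtree \<Rightarrow> bool" where
  "is_leaf t \<longleftrightarrow> children t = []"

definition two_protected :: "mtree \<Rightarrow> bool" where
  "two_protected t \<longleftrightarrow> \<not> is_leaf t \<and> (\<forall>c\<in>set (children t). \<not> is_leaf c)"

definition protected_fraction :: "mtree \<Rightarrow> real" where
  "protected_fraction t =
     real (length (filter two_protected (nodes t))) / real (length (nodes t))"

lemma delete_empty_simp [simp]:
  "delete_empty (Node ks ts) = Node ks (map delete_empty (filter (\<lambda>t. keys t \<noteq> []) ts))"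
  by (simp add: filter_map comp_def)

declare delete_empty.simps [simp del]

end

theory Submission
  imports Defs
begin

text \<open>
  Fix \<open>m\<close>, let \<open>c\<close> be the almost sure limit, and let the score of a tree be the number of its
  2-protected nodes minus \<open>c\<close> times the number of its nodes. The score is \<open>o(n)\<close> almost surely, and by
  dominated convergence so is its mean \<open>a\<^sub>n\<close>, which is an average over random permutations, as only
  the relative order of the keys matters. The gaps between the keys of the root form a uniform
  composition of \<open>n - m + 1\<close> into \<open>m\<close> parts, and given the gaps the subtrees are again random
  search trees; this yields a recursion \<open>a\<^sub>n = b\<^sub>n + \<Sum>\<^sub>k q\<^sub>n\<^sub>k a\<^sub>k\<close>, where \<open>b\<^sub>n\<close> is the probability
  that the root is 2-protected minus \<open>c\<close>.

  The weights \<open>w\<^sub>n = 1 / ((n + 1) (n + 2))\<close> satisfy \<open>\<Sum>\<^sub>n w\<^sub>n q\<^sub>n\<^sub>k = w\<^sub>k\<close>, so \<open>a\<^sub>n = o(n)\<close> forces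
  \<open>\<Sum>\<^sub>n w\<^sub>n b\<^sub>n = 0\<close>, which determines \<open>c\<close>. Sums over all compositions are evaluated with the beta
  integral: \<open>w\<^sub>n\<close> divided by the number of compositions is \<open>1 / m\<close> times the integral of
  \<open>z\<^sup>s (1 - z)\<^sup>m\<close> over \<open>[0, 1]\<close>, where \<open>s = n - m + 1\<close>, so that the parts become independent geometric
  variables. The root is 2-protected iff every child is empty or has at least \<open>m\<close> keys and not
  all are empty, hence \<open>c\<close> is \<open>2 / m\<close> times the integral of \<open>(1 - z + z\<^sup>m)\<^sup>m - (1 - z)\<^sup>m\<close>.
\<close>

section \<open>Recursive structure of search trees\<close>

text \<open>The index \<open>i\<close> of \<open>insert_key\<close>: the child that receives
  \<open>x\<close> below a full node with keys \<open>qs\<close>.\<close>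

definition slot :: "real list \<Rightarrow> real \<Rightarrow> nat" where
  "slot qs x = length (filter (\<lambda>k. k < x) qs)"

text \<open>The key sequences passed on to the \<open>m\<close> children, each in order of
  arrival.\<close>

definition blocks :: "nat \<Rightarrow> real list \<Rightarrow> real list \<Rightarrow> real list list" where
  "blocks m qs ys = map (\<lambda>i. filter (\<lambda>x. slot qs x = i) ys) [0..<m]"

lemma insert_key_full:
  assumes "length qs = m - 1" "m \<ge> 1" "length ts = m"
  shows "insert_key m x (Node qs ts) = Node qs (ts[slot qs x := insert_key m x (ts ! slot qs x)])"
proof -
  have "slot qs x \<le> length qs" by (simp add: slot_def)
  then have "slot qs x < m" using assms by simp
  then show ?thesis using assms by (subst insert_key.simps) (simp add: slot_def Let_def)
qed

text \<open>A full root never changes and insertions into different children do not interact, so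
  each child sees only its own subsequence of the keys.\<close>

lemma fold_insert_key_full:
  assumes "length qs = m - 1" "m \<ge> 1" "length ts = m"
  shows "fold (insert_key m) ys (Node qs ts) =
    Node qs (map (\<lambda>i. fold (insert_key m) (filter (\<lambda>x. slot qs x = i) ys) (ts ! i)) [0..<m])"
  using assms
proof (induction ys arbitrary: ts)
  case Nil
  have "map ((!) ts) [0..<m] = ts" using Nil by (metis map_nth)
  then show ?case using Nil by simp
next
  case (Cons y ys)
  have "slot qs y \<le> length qs" by (simp add: slot_def)
  then have s: "slot qs y < m" using Cons.prems by simp
  show ?case
    using s Cons.prems insert_key_full[OF Cons.prems, of y]
      Cons.IH[OF Cons.prems(1,2), of "ts[slot qs y := insert_key m y (ts ! slot qs y)]"]
    by (auto simp del: insert_key.simps simp: nth_list_update)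
qed

lemma fold_insert_key_short:
  assumes "length xs < m - 1"
  shows "fold (insert_key m) xs (Node [] []) = Node xs []"
  using assms
  by (induction xs rule: rev_induct) auto

lemma fold_insert_key_root:
  assumes "length qs = m - 1" "m \<ge> 2"
  shows "fold (insert_key m) qs (Node [] []) = Node qs (replicate m (Node [] []))"
proof -
  \<comment> \<open>The last key is split off because its insertion creates the empty
    children.\<close>
  from assms obtain ps q where qs: "qs = ps @ [q]" by (metis Suc_1 Suc_diff_1 Suc_le_eq append_butlast_last_id diff_is_0_eq' length_0_conv not_less_eq_eq le_refl zero_less_diff)
  have "length ps < m - 1" using assms qs by simp
  then show ?thesis using assms qs by (simp add: fold_insert_key_short)
qed

lemma fold_insert_key_append:
  assumes "length qs = m - 1" "m \<ge> 2"
  shows "fold (insert_key m) (qs @ ys) (Node [] []) =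
    Node qs (map (\<lambda>zs. fold (insert_key m) zs (Node [] [])) (blocks m qs ys))"
  using assms
  by (simp add: fold_insert_key_root fold_insert_key_full blocks_def)

lemma split_at_root:
  assumes "\<not> length xs < m - 1"
  obtains qs ys where "xs = qs @ ys" "length qs = m - 1"
proof -
  have "xs = take (m - 1) xs @ drop (m - 1) xs" "length (take (m - 1) xs) = m - 1"
    using assms by auto
  then show ?thesis using that by blast
qed

text \<open>This turns the deletion of empty nodes into the removal of empty lists from
  \<open>blocks\<close>.\<close>

lemma keys_fold_insert_key:
  assumes "m \<ge> 2"
  shows "keys (fold (insert_key m) xs (Node [] [])) = [] \<longleftrightarrow> xs = []"
proof (cases "length xs < m - 1")
  case True
  then show ?thesis by (simp add: fold_insert_key_short)
next
  case False
  then obtain qs ys where *: "xs = qs @ ys" "length qs = m - 1" by (rule split_at_root)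
  then have "qs \<noteq> []" using assms by auto
  then show ?thesis using fold_insert_key_append[OF *(2) assms] * by auto
qed

lemma search_tree_short:
  assumes "length xs < m - 1"
  shows "search_tree m xs = Node xs []"
  using assms by (simp add: search_tree_def fold_insert_key_short)

lemma search_tree_append:
  assumes "length qs = m - 1" "m \<ge> 2"
  shows "search_tree m (qs @ ys) =
    Node qs (map (search_tree m) (filter (\<lambda>zs. zs \<noteq> []) (blocks m qs ys)))"
  unfolding search_tree_def fold_insert_key_append[OF assms]
  by (simp add: filter_map comp_def keys_fold_insert_key assms)

text \<open>Each key lies in exactly one block, because \<open>slot qs y\<close> is at most
  \<open>length qs = m - 1\<close>.\<close>

lemma sum_list_length_blocks:
  assumes "length qs = m - 1" "m \<ge> 1"
  shows "sum_list (map length (blocks m qs ys)) = length ys"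
proof (induction ys)
  case Nil
  then show ?case by (simp add: blocks_def)
next
  case (Cons y ys)
  have "slot qs y \<le> length qs" by (simp add: slot_def)
  then have s: "slot qs y < m" using assms by simp
  have "sum_list (map length (blocks m qs (y # ys))) =
      (\<Sum>i\<leftarrow>[0..<m]. length (filter (\<lambda>x. slot qs x = i) ys) + (if i = slot qs y then 1 else 0))"
    unfolding blocks_def map_map by (intro arg_cong[where f = sum_list] map_cong) auto
  also have "\<dots> = sum_list (map length (blocks m qs ys)) + (\<Sum>i\<leftarrow>[0..<m]. if i = slot qs y then 1 else 0)"
    by (simp add: sum_list_addf blocks_def comp_def)
  also have "(\<Sum>i\<leftarrow>[0..<m]. if i = slot qs y then 1 else 0) = (1::nat)"
    using s by (simp add: interv_sum_list_conv_sum_set_nat)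
  finally show ?case using Cons by simp
qed

text \<open>The bound is \<open>m\<close> and not \<open>m - 1\<close>: a root with exactly
  \<open>m - 1\<close> keys has only empty children, and these are deleted.\<close>

lemma is_leaf_search_tree:
  assumes "m \<ge> 2"
  shows "is_leaf (search_tree m xs) \<longleftrightarrow> length xs < m"
proof (cases "length xs < m - 1")
  case True
  then show ?thesis by (simp add: search_tree_short is_leaf_def)
next
  case False
  then obtain qs ys where *: "xs = qs @ ys" "length qs = m - 1" by (rule split_at_root)
  have "is_leaf (search_tree m xs) \<longleftrightarrow> (\<forall>zs\<in>set (blocks m qs ys). length zs = 0)"
    using * assms by (auto simp: search_tree_append is_leaf_def filter_empty_conv)
  also have "\<dots> \<longleftrightarrow> sum_list (map length (blocks m qs ys)) = 0"
    by (simp add: sum_list_eq_0_iff)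
  also have "\<dots> \<longleftrightarrow> length xs < m"
    using * assms by (subst sum_list_length_blocks) (simp_all del: length_0_conv, linarith)
  finally show ?thesis .
qed

text \<open>In terms of the key counts of the children, using \<open>is_leaf_search_tree\<close>:
  some child survives deletion, and no surviving child is a leaf.\<close>

definition protected_split :: "nat \<Rightarrow> nat list \<Rightarrow> bool" where
  "protected_split m ks \<longleftrightarrow> (\<exists>k\<in>set ks. k \<noteq> 0) \<and> (\<forall>k\<in>set ks. k = 0 \<or> m \<le> k)"

lemma two_protected_search_tree:
  assumes "length qs = m - 1" "m \<ge> 2"
  shows "two_protected (search_tree m (qs @ ys)) \<longleftrightarrow>
    protected_split m (map length (blocks m qs ys))"
  using assms
  by (auto simp: two_protected_def is_leaf_search_tree search_tree_append protected_split_def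
        is_leaf_def[of "Node _ _"] filter_empty_conv not_less)

text \<open>The summand for no keys is \<open>0\<close>, as an empty child is deleted.\<close>

definition score :: "real \<Rightarrow> nat \<Rightarrow> real list \<Rightarrow> real" where
  "score c m xs = (if xs = [] then 0
     else \<Sum>t\<leftarrow>nodes (search_tree m xs). of_bool (two_protected t) - c)"

text \<open>The node list splits into the root and the nodes of the child subtrees; empty blocks add
  \<open>0\<close> by the convention in \<open>score\<close>.\<close>

lemma score_append:
  assumes "length qs = m - 1" "m \<ge> 2"
  shows "score c m (qs @ ys) =
    of_bool (protected_split m (map length (blocks m qs ys))) - c
      + (\<Sum>zs\<leftarrow>blocks m qs ys. score c m zs)"
proof -
  let ?h = "\<lambda>t. of_bool (two_protected t) - c"
  have ne: "qs \<noteq> []" using assms by auto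
  have *: "(\<Sum>t\<leftarrow>concat (map nodes (map (search_tree m) (filter (\<lambda>zs. zs \<noteq> []) zss))). ?h t)
      = (\<Sum>zs\<leftarrow>zss. score c m zs)" for zss
    by (induction zss) (auto simp: score_def)
  have "score c m (qs @ ys) = ?h (search_tree m (qs @ ys))
      + (\<Sum>t\<leftarrow>concat (map nodes (children (search_tree m (qs @ ys)))). ?h t)"
    using ne by (cases "search_tree m (qs @ ys)") (simp add: score_def)
  also have "children (search_tree m (qs @ ys)) =
      map (search_tree m) (filter (\<lambda>zs. zs \<noteq> []) (blocks m qs ys))"
    by (simp add: search_tree_append assms)
  finally show ?thesis unfolding * two_protected_search_tree[OF assms] .
qed

lemma score_short:
  assumes "length xs < m - 1"
  shows "score c m xs = (if xs = [] then 0 else - c)"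
  using assms by (simp add: score_def search_tree_short two_protected_def is_leaf_def)

text \<open>Every remaining node holds a key of its own. Hence the score is at most the number of
  keys times the deviation of the protected fraction from \<open>c\<close>.\<close>

lemma length_nodes_search_tree:
  assumes "m \<ge> 2" "xs \<noteq> []"
  shows "length (nodes (search_tree m xs)) \<le> length xs"
  using assms(2)
proof (induction xs rule: length_induct)
  case (1 xs)
  show ?case
  proof (cases "length xs < m - 1")
    case True
    then show ?thesis using 1 by (cases xs) (simp_all add: search_tree_short)
  next
    case False
    then obtain qs ys where *: "xs = qs @ ys" "length qs = m - 1" by (rule split_at_root)
    then have ne: "qs \<noteq> []" using assms by auto
    have IH: "length (nodes (search_tree m zs)) \<le> length zs" if "zs \<in> set (blocks m qs ys)" "zs \<noteq> []" for zs
    proof -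
      from that have "length zs \<le> length ys" by (auto simp: blocks_def)
      with ne * have "length zs < length xs" by (cases qs) auto
      with 1 that show ?thesis by auto
    qed
    have "length (concat (map nodes (map (search_tree m) (filter (\<lambda>zs. zs \<noteq> []) zss))))
        \<le> sum_list (map length zss)" if "set zss \<subseteq> set (blocks m qs ys)" for zss
      using that by (induction zss) (auto intro!: add_mono IH)
    from this[of "blocks m qs ys"] show ?thesis
      using * ne assms
      by (simp add: search_tree_append sum_list_length_blocks Suc_le_eq le_diff_conv)
  qed
qed

lemma blocks_map:
  "blocks m qs (map u zs) = map (\<lambda>i. map u (filter (\<lambda>z. slot qs (u z) = i) zs)) [0..<m]"
  by (simp add: blocks_def filter_map comp_def)

text \<open>Keys enter through comparisons only. Both key lists are images of one list
  \<open>zs\<close>, so that the induction can pass to the sublists of \<open>zs\<close> that form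
  the blocks.\<close>

lemma score_order_invariant:
  assumes "m \<ge> 2" "\<And>a b. a \<in> set zs \<Longrightarrow> b \<in> set zs \<Longrightarrow> u a < u b \<longleftrightarrow> v a < v b"
  shows "score c m (map u zs) = score c m (map v zs)"
  using assms(2)
proof (induction zs rule: length_induct)
  case (1 zs)
  show ?case
  proof (cases "length zs < m - 1")
    case True
    then show ?thesis by (simp add: score_short)
  next
    case False
    define ps where "ps = take (m - 1) zs"
    define ys where "ys = drop (m - 1) zs"
    have zs: "zs = ps @ ys" "length ps = m - 1" using False by (auto simp: ps_def ys_def)
    have ne: "ps \<noteq> []" using zs assms by auto
    have slot: "slot (map u ps) (u z) = slot (map v ps) (v z)" if "z \<in> set ys" for z
      using that 1 zs by (auto simp: slot_def filter_map comp_def intro!: arg_cong[where f = length] filter_cong)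
    \<comment> \<open>By \<open>slot\<close>, \<open>u\<close> and \<open>v\<close> sort the
      elements of \<open>ys\<close> into the same blocks.\<close>
    define bs where "bs = map (\<lambda>i. filter (\<lambda>z. slot (map u ps) (u z) = i) ys) [0..<m]"
    have bu: "blocks m (map u ps) (map u ys) = map (map u) bs"
      by (simp add: blocks_map bs_def)
    have bv: "blocks m (map v ps) (map v ys) = map (map v) bs"
      unfolding blocks_map bs_def map_map using slot
      by (auto simp: intro!: map_cong filter_cong)
    have "score c m (map u b) = score c m (map v b)" if "b \<in> set bs" for b
    proof -
      have "length b \<le> length ys" "set b \<subseteq> set zs" using that by (auto simp: bs_def zs)
      moreover have "length ys < length zs" using ne zs by (cases ps) auto
      ultimately show ?thesis using 1 by (meson less_le_trans le_less_trans subsetD)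
    qed
    then have "map (score c m \<circ> map u) bs = map (score c m \<circ> map v) bs" by auto
    then show ?thesis using zs assms
      by (simp add: score_append bu bv comp_def cong: map_cong)
  qed
qed

section \<open>Random permutations\<close>

text \<open>Cutting a permutation after \<open>r\<close> entries amounts to choosing the set
  \<open>Q\<close> of the first \<open>r\<close> elements and, independently, orders of
  \<open>Q\<close> and of its complement.\<close>

lemma sum_permutations_of_set_split:
  fixes \<phi> :: "'b list \<Rightarrow> 'b list \<Rightarrow> 'c::comm_monoid_add"
  assumes "finite S" "r \<le> card S"
  shows "(\<Sum>xs\<in>permutations_of_set S. \<phi> (take r xs) (drop r xs)) =
    (\<Sum>Q | Q \<subseteq> S \<and> card Q = r.
       \<Sum>qs\<in>permutations_of_set Q. \<Sum>ys\<in>permutations_of_set (S - Q). \<phi> qs ys)"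
proof -
  let ?A = "SIGMA Q:{Q. Q \<subseteq> S \<and> card Q = r}. permutations_of_set Q \<times> permutations_of_set (S - Q)"
  have "(\<Sum>xs\<in>permutations_of_set S. \<phi> (take r xs) (drop r xs)) = (\<Sum>(Q, qs, ys)\<in>?A. \<phi> qs ys)"
  proof (rule sum.reindex_bij_witness[where j = "\<lambda>xs. (set (take r xs), take r xs, drop r xs)"
        and i = "\<lambda>(Q, qs, ys). qs @ ys"], goal_cases)
    case (2 xs)
    then have xs: "set xs = S" "distinct xs" by (auto dest: permutations_of_setD)
    then have l: "length xs = card S" using distinct_card by fastforce
    have "set xs = set (take r xs) \<union> set (drop r xs)" by (metis append_take_drop_id set_append)
    moreover have "set (take r xs) \<inter> set (drop r xs) = {}" by (simp add: set_take_disj_set_drop_if_distinct xs)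
    ultimately have "set (drop r xs) = S - set (take r xs)" using xs by auto
    moreover have "card (set (take r xs)) = r" using xs l assms by (simp add: distinct_card)
    ultimately show ?case using xs set_take_subset[of r xs]
      by (auto intro!: permutations_of_setI)
  next
    case (3 b)
    then obtain Q qs ys where "b = (Q, qs, ys)" "Q \<subseteq> S" "card Q = r"
      "qs \<in> permutations_of_set Q" "ys \<in> permutations_of_set (S - Q)" by auto
    then have b: "b = (Q, qs, ys)" "Q \<subseteq> S" "card Q = r"
      "set qs = Q" "distinct qs" "set ys = S - Q" "distinct ys"
      by (auto dest: permutations_of_setD)
    then have "length qs = r" using distinct_card by fastforce
    with b show ?case by auto
  next
    case (4 b)
    then obtain Q qs ys where "b = (Q, qs, ys)" "Q \<subseteq> S" "card Q = r"
      "qs \<in> permutations_of_set Q" "ys \<in> permutations_of_set (S - Q)" by auto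
    then have b: "b = (Q, qs, ys)" "Q \<subseteq> S" "card Q = r"
      "set qs = Q" "distinct qs" "set ys = S - Q" "distinct ys"
      by (auto dest: permutations_of_setD)
    then show ?case by (auto intro!: permutations_of_setI)
  qed auto
  also have "\<dots> = (\<Sum>Q | Q \<subseteq> S \<and> card Q = r.
       \<Sum>qs\<in>permutations_of_set Q. \<Sum>ys\<in>permutations_of_set (S - Q). \<phi> qs ys)"
    using assms by (simp add: sum.Sigma sum.cartesian_product)
  finally show ?thesis .
qed

definition perm_mean :: "('b list \<Rightarrow> real) \<Rightarrow> 'b set \<Rightarrow> real" where
  "perm_mean h S = (\<Sum>xs\<in>permutations_of_set S. h xs) / fact (card S)"

lemma perm_mean_expectation:
  assumes "finite S"
  shows "perm_mean h S = measure_pmf.expectation (pmf_of_set (permutations_of_set S)) h"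
  using assms by (simp add: perm_mean_def integral_pmf_of_set)

text \<open>The elements selected by \<open>P\<close> appear in uniformly random order within a
  uniformly random permutation.\<close>

lemma sum_permutations_of_set_filter:
  assumes "finite B"
  shows "(\<Sum>ys\<in>permutations_of_set B. h (filter P ys)) = fact (card B) * perm_mean h {x\<in>B. P x}"
proof -
  have "map_pmf (filter P) (pmf_of_set (permutations_of_set B)) =
      map_pmf fst (map_pmf (partition P) (pmf_of_set (permutations_of_set B)))"
    by (simp add: pmf.map_comp comp_def)
  also have "\<dots> = pmf_of_set (permutations_of_set {x\<in>B. P x})"
    by (simp add: partition_random_permutations assms map_fst_pair_pmf)
  finally have *: "map_pmf (filter P) (pmf_of_set (permutations_of_set B)) = \<dots>" .
  have "perm_mean h {x\<in>B. P x} = measure_pmf.expectation (pmf_of_set (permutations_of_set B)) (\<lambda>ys. h (filter P ys))"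
    using assms by (simp add: perm_mean_expectation flip: *)
  also have "\<dots> = (\<Sum>ys\<in>permutations_of_set B. h (filter P ys)) / fact (card B)"
    using assms by (simp add: integral_pmf_of_set)
  finally show ?thesis by simp
qed

text \<open>The keys \<open>0, ..., n - 1\<close> represent any \<open>n\<close> distinct keys, by
  \<open>perm_mean_score\<close> below.\<close>

definition mean_score :: "real \<Rightarrow> nat \<Rightarrow> nat \<Rightarrow> real" where
  "mean_score c m n = perm_mean (score c m) (real ` {..<n})"

lemma perm_mean_score_image:
  fixes f g :: "'b \<Rightarrow> real"
  assumes "m \<ge> 2" "inj_on f A" "inj_on g A" "\<And>a b. a \<in> A \<Longrightarrow> b \<in> A \<Longrightarrow> f a < f b \<longleftrightarrow> g a < g b"
  shows "perm_mean (score c m) (f ` A) = perm_mean (score c m) (g ` A)"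
proof -
  have inj: "inj_on (map h) (permutations_of_set A)" if "inj_on h A" for h :: "'b \<Rightarrow> real"
    by (intro inj_on_mapI inj_on_subset[OF that]) (auto dest: permutations_of_setD)
  have "score c m (map f xs) = score c m (map g xs)" if "xs \<in> permutations_of_set A" for xs
    using that assms by (intro score_order_invariant) (auto dest: permutations_of_setD)
  then show ?thesis using assms
    by (simp add: perm_mean_def permutations_of_set_image_inj sum.reindex inj card_image)
qed

lemma perm_mean_score:
  assumes "m \<ge> 2" "finite S"
  shows "perm_mean (score c m) S = mean_score c m (card S)"
proof -
  \<comment> \<open>Indexing \<open>S\<close> by rank is an order isomorphism from
    \<open>{..<card S}\<close>, to which \<open>perm_mean_score_image\<close> applies.\<close>
  obtain ls where ls: "sorted_wrt (<) ls" "length ls = card S" "set ls = S"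
    using that[of "sorted_list_of_set S"] assms by simp
  have mono: "ls ! i < ls ! j \<longleftrightarrow> i < j" if "i < card S" "j < card S" for i j
  proof (cases i j rule: linorder_cases)
    case less
    then show ?thesis using sorted_wrt_nth_less[OF ls(1) less] that ls by simp
  next
    case greater
    then have "ls ! j < ls ! i" using sorted_wrt_nth_less[OF ls(1) greater] that ls by simp
    then show ?thesis using greater by simp
  qed simp
  have "(!) ls ` {..<length ls} = set ls"
    by (auto simp: set_conv_nth)
  then have image: "(!) ls ` {..<card S} = S"
    using ls by simp
  have "inj_on ((!) ls) {..<card S}"
    using mono by (metis inj_onI lessThan_iff less_irrefl nat_neq_iff)
  then have "perm_mean (score c m) ((!) ls ` {..<card S}) = perm_mean (score c m) (real ` {..<card S})"
    using assms mono by (intro perm_mean_score_image) auto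
  then show ?thesis by (simp only: mean_score_def image)
qed

section \<open>Gaps of a subset and compositions\<close>

definition gap :: "'b::linorder set \<Rightarrow> 'b set \<Rightarrow> nat \<Rightarrow> nat" where
  "gap S Q i = card {x \<in> S - Q. card {q\<in>Q. q < x} = i}"

lemma sum_gap:
  assumes "finite S" "Q \<subseteq> S" "card Q = r"
  shows "(\<Sum>i<Suc r. gap S Q i) = card S - r"
proof -
  have fin: "finite Q" using assms finite_subset by blast
  have "S - Q = (\<Union>i<Suc r. {x \<in> S - Q. card {q\<in>Q. q < x} = i})"
    using assms fin by (auto simp: less_Suc_eq_le intro!: card_mono)
  moreover have "card (\<Union>i<Suc r. {x \<in> S - Q. card {q\<in>Q. q < x} = i}) = (\<Sum>i<Suc r. gap S Q i)"
    unfolding gap_def by (rule card_UN_disjoint) (use assms in auto)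
  ultimately have "card (S - Q) = (\<Sum>i<Suc r. gap S Q i)" by (simp only:)
  then show ?thesis using assms fin by (simp add: card_Diff_subset)
qed

text \<open>The maximum of \<open>S\<close> belongs to \<open>Q\<close> iff the last gap is empty.\<close>

lemma gap_inj:
  fixes S :: "'b::linorder set"
  assumes "finite S" "Q \<subseteq> S" "Q' \<subseteq> S" "card Q = r" "card Q' = r"
    and "\<And>i. i \<le> r \<Longrightarrow> gap S Q i = gap S Q' i"
  shows "Q = Q'"
  using assms
proof (induction S arbitrary: r Q Q' rule: finite_linorder_max_induct)
  case empty
  then show ?case by simp
next
  case (insert b A)
  have nb: "b \<notin> A" using insert by auto
  \<comment> \<open>A maximum outside \<open>R\<close> exceeds all of \<open>R\<close>, so it is
    counted in the last gap.\<close>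
  have out: "gap (insert b A) R i = gap A R i + of_bool (i = r)"
    if "R \<subseteq> insert b A" "card R = r" "b \<notin> R" for R i r
  proof -
    have RA: "R \<subseteq> A" using that by auto
    have "{q \<in> R. q < b} = R" using RA insert by auto
    then have "{x \<in> insert b A - R. card {q\<in>R. q < x} = i} =
        (if i = r then insert b {x \<in> A - R. card {q\<in>R. q < x} = i}
         else {x \<in> A - R. card {q\<in>R. q < x} = i})"
      using that by auto
    then show ?thesis using nb insert(1) by (auto simp: gap_def)
  qed
  \<comment> \<open>Nothing lies above a maximum in \<open>R\<close>; removing it from
    \<open>R\<close> and from the ground set leaves the other gaps unchanged.\<close>
  have ins: "gap (insert b A) R i = (if i = r then 0 else gap A (R - {b}) i)"
    if "R \<subseteq> insert b A" "card R = r" "b \<in> R" for R i r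
  proof -
    have fR: "finite R" using that insert(1) finite_subset by blast
    have c: "card {q\<in>R - {b}. q < x} < r" for x
    proof -
      have "card {q\<in>R - {b}. q < x} \<le> card (R - {b})" using fR by (intro card_mono) auto
      also have "\<dots> < r" using that fR by (metis card_Diff1_less)
      finally show ?thesis .
    qed
    have "{q \<in> R. q < x} = {q \<in> R - {b}. q < x}" if "x \<in> A" for x
      using that insert by fastforce
    moreover have "insert b A - R = A - (R - {b})" using that nb by auto
    ultimately have "{x \<in> insert b A - R. card {q\<in>R. q < x} = i} =
        {x \<in> A - (R - {b}). card {q\<in>R - {b}. q < x} = i}" by auto
    then show ?thesis using c[THEN less_imp_neq] by (auto simp: gap_def)
  qed
  have iff: "b \<in> R \<longleftrightarrow> gap (insert b A) R r = 0" if "R \<subseteq> insert b A" "card R = r" for R r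
    using out[OF that, of r] ins[OF that, of r] by fastforce
  show ?case
  proof (cases "b \<in> Q")
    case True
    then have b: "b \<in> Q" "b \<in> Q'" using iff[of Q] iff[of Q'] insert.prems by auto
    have fin: "finite Q" "finite Q'" using insert finite_subset[of _ "insert b A"] by auto
    have "Q - {b} = Q' - {b}"
    proof (rule insert.IH[where r = "r - 1"])
      have r: "r > 0" using b fin insert.prems by (metis card_gt_0_iff empty_iff)
      fix i assume "i \<le> r - 1"
      with r have "i \<le> r" "i \<noteq> r" by auto
      then show "gap A (Q - {b}) i = gap A (Q' - {b}) i"
        using ins[of Q r i] ins[of Q' r i] b insert.prems by auto
    qed (use b insert.prems in \<open>auto simp: fin\<close>)
    then show ?thesis using b by auto
  next
    case False
    then have b: "b \<notin> Q" "b \<notin> Q'" using iff[of Q] iff[of Q'] insert.prems by auto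
    show ?thesis
    proof (rule insert.IH[where r = r])
      fix i assume "i \<le> r"
      then show "gap A Q i = gap A Q' i"
        using out[of Q r i] out[of Q' r i] b insert.prems by auto
    qed (use b insert.prems in auto)
  qed
qed

definition compositions :: "nat \<Rightarrow> nat \<Rightarrow> nat list set" where
  "compositions m s = {ks. length ks = m \<and> sum_list ks = s}"

lemma finite_compositions [simp]: "finite (compositions m s)"
proof (rule finite_subset)
  show "compositions m s \<subseteq> {ks. set ks \<subseteq> {..s} \<and> length ks = m}"
    by (auto simp: compositions_def intro: member_le_sum_list)
  show "finite {ks. set ks \<subseteq> {..s} \<and> length ks = m}"
    by (rule finite_lists_length_eq) simp
qed

lemma card_compositions: "card (compositions (Suc r) s) = (s + r) choose r"
  unfolding compositions_def card_length_sum_list using binomial_symmetric[of r "s + r"] by simp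

text \<open>Injectivity is \<open>gap_inj\<close>, and both sides have
  \<open>card S choose r\<close> elements. Hence the gaps of a uniformly random
  \<open>r\<close>-subset form a uniformly random composition.\<close>

lemma bij_betw_gaps:
  fixes S :: "'b::linorder set"
  assumes "finite S" "r \<le> card S"
  shows "bij_betw (\<lambda>Q. map (gap S Q) [0..<Suc r]) {Q. Q \<subseteq> S \<and> card Q = r}
    (compositions (Suc r) (card S - r))"
  unfolding bij_betw_def
proof
  let ?g = "\<lambda>Q. map (gap S Q) [0..<Suc r]" and ?A = "{Q. Q \<subseteq> S \<and> card Q = r}"
  show inj: "inj_on ?g ?A"
  proof (rule inj_onI)
    fix Q Q' assume *: "Q \<in> ?A" "Q' \<in> ?A" "?g Q = ?g Q'"
    then have "\<forall>i\<in>set [0..<Suc r]. gap S Q i = gap S Q' i" by (simp only: map_eq_conv)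
    with * show "Q = Q'"
      using assms by (intro gap_inj[of S _ _ r]) (auto simp: less_Suc_eq_le)
  qed
  have "?g ` ?A \<subseteq> compositions (Suc r) (card S - r)"
    using assms sum_gap[of S _ r]
    by (auto simp del: upt_Suc sum.lessThan_Suc simp: compositions_def interv_sum_list_conv_sum_set_nat atLeast0LessThan)
  moreover have "card (?g ` ?A) = card (compositions (Suc r) (card S - r))"
    using assms by (simp add: card_image[OF inj] n_subsets card_compositions del: upt_Suc)
  ultimately show "?g ` ?A = compositions (Suc r) (card S - r)"
    by (intro card_subset_eq) auto
qed

text \<open>The sum over all permutations is split by the set \<open>Q\<close> of root keys; given
  \<open>Q\<close>, each block is a uniformly random permutation of one gap.\<close>

lemma mean_score_rec:
  assumes "m \<ge> 2" "n \<ge> m - 1"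
  shows "mean_score c m n = (\<Sum>ks\<in>compositions m (n - (m - 1)).
    of_bool (protected_split m ks) - c + (\<Sum>k\<leftarrow>ks. mean_score c m k)) / (n choose (m - 1))"
proof -
  define S where "S = real ` {..<n}"
  define r where "r = m - 1"
  have S: "finite S" "card S = n" by (auto simp: S_def card_image)
  have r: "m = Suc r" "r \<le> n" using assms by (auto simp: r_def)
  define T where "T = (\<lambda>ks. of_bool (protected_split m ks) - c + (\<Sum>k\<leftarrow>ks. mean_score c m k))"
  \<comment> \<open>The sum over the later keys depends on \<open>Q\<close> through its gaps only,
    and not on the order \<open>qs\<close> of the root keys.\<close>
  have inner: "(\<Sum>ys\<in>permutations_of_set (S - Q). score c m (qs @ ys)) =
      fact (n - r) * T (map (gap S Q) [0..<Suc r])"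
    if Q: "Q \<subseteq> S" "card Q = r" and qs: "qs \<in> permutations_of_set Q" for Q qs
  proof -
    have fQ: "finite Q" using Q S finite_subset by blast
    have cS: "card (S - Q) = n - r" using Q fQ S by (simp add: card_Diff_subset)
    have dq: "set qs = Q" "distinct qs" using qs by (auto dest: permutations_of_setD)
    then have lq: "length qs = m - 1" using Q r distinct_card by fastforce
    have slot: "slot qs x = card {q\<in>Q. q < x}" for x
      unfolding slot_def using dq distinct_card[of "filter (\<lambda>k. k < x) qs"] by simp
    have len: "map length (blocks m qs ys) = map (gap S Q) [0..<Suc r]"
      if "ys \<in> permutations_of_set (S - Q)" for ys
    proof -
      have "set ys = S - Q" "distinct ys" using that by (auto dest: permutations_of_setD)
      then have "length (filter (\<lambda>x. slot qs x = i) ys) = gap S Q i" for i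
        unfolding gap_def slot[symmetric]
        using distinct_card[of "filter (\<lambda>x. slot qs x = i) ys"] by simp
      then show ?thesis by (simp add: blocks_def r del: upt_Suc)
    qed
    have "(\<Sum>ys\<in>permutations_of_set (S - Q). score c m (qs @ ys)) =
        (\<Sum>ys\<in>permutations_of_set (S - Q).
          of_bool (protected_split m (map (gap S Q) [0..<Suc r])) - c +
           (\<Sum>i<m. score c m (filter (\<lambda>x. slot qs x = i) ys)))"
    proof (intro sum.cong refl)
      fix ys assume "ys \<in> permutations_of_set (S - Q)"
      then show "score c m (qs @ ys) = of_bool (protected_split m (map (gap S Q) [0..<Suc r])) - c +
           (\<Sum>i<m. score c m (filter (\<lambda>x. slot qs x = i) ys))"
        using score_append[OF lq assms(1), of c ys] len
        by (simp add: blocks_def comp_def interv_sum_list_conv_sum_set_nat atLeast0LessThan del: upt_Suc)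
    qed
    also have "\<dots> = fact (n - r) * (of_bool (protected_split m (map (gap S Q) [0..<Suc r])) - c)
        + (\<Sum>i<m. \<Sum>ys\<in>permutations_of_set (S - Q). score c m (filter (\<lambda>x. slot qs x = i) ys))"
      using S by (simp add: sum.distrib cS sum.swap[of _ "{..<m}"] del: upt_Suc)
    \<comment> \<open>Each block is a filtered random permutation, so its mean score depends only on
      its size.\<close>
    also have "(\<Sum>i<m. \<Sum>ys\<in>permutations_of_set (S - Q). score c m (filter (\<lambda>x. slot qs x = i) ys))
        = (\<Sum>i<m. fact (n - r) * mean_score c m (gap S Q i))"
      using S assms by (intro sum.cong refl)
        (simp add: sum_permutations_of_set_filter cS perm_mean_score gap_def slot)
    also have "fact (n - r) * (of_bool (protected_split m (map (gap S Q) [0..<Suc r])) - c) + \<dots>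
        = fact (n - r) * T (map (gap S Q) [0..<Suc r])"
      by (simp add: T_def r comp_def interv_sum_list_conv_sum_set_nat atLeast0LessThan
          sum_distrib_left distrib_left del: upt_Suc sum.lessThan_Suc)
    finally show ?thesis .
  qed
  have "(\<Sum>xs\<in>permutations_of_set S. score c m xs) =
      (\<Sum>xs\<in>permutations_of_set S. score c m (take r xs @ drop r xs))" by simp
  also have "\<dots> = (\<Sum>Q | Q \<subseteq> S \<and> card Q = r. \<Sum>qs\<in>permutations_of_set Q.
      fact (n - r) * T (map (gap S Q) [0..<Suc r]))"
    by (subst sum_permutations_of_set_split[OF S(1) r(2)[folded S(2)]])
      (intro sum.cong refl inner; simp)
  also have "\<dots> = (\<Sum>Q | Q \<subseteq> S \<and> card Q = r. fact r * fact (n - r) * T (map (gap S Q) [0..<Suc r]))"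
    using S by (intro sum.cong refl) (auto simp: finite_subset[of _ S] simp del: upt_Suc)
  also have "\<dots> = (\<Sum>ks\<in>compositions m (n - r). fact r * fact (n - r) * T ks)"
    using sum.reindex_bij_betw[OF bij_betw_gaps[of S r], of "\<lambda>ks. fact r * fact (n - r) * T ks"] S r by simp
  finally have "(\<Sum>xs\<in>permutations_of_set S. score c m xs) =
      fact r * fact (n - r) * (\<Sum>ks\<in>compositions m (n - r). T ks)"
    by (simp add: sum_distrib_left)
  then have "mean_score c m n = (\<Sum>ks\<in>compositions m (n - r). T ks) / (n choose r)"
    using r by (simp add: mean_score_def perm_mean_def S(2) binomial_fact S_def[symmetric])
  then show ?thesis by (simp add: T_def r_def)
qed

section \<open>Independent keys\<close>

text \<open>Links permutations as lists, used in the recursion, to permutations as functions, used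
  for the order of a sample. Surjectivity follows from injectivity by counting.\<close>

lemma bij_betw_permutes_permutations:
  "bij_betw (\<lambda>\<sigma>. map \<sigma> [0..<n]) {\<sigma>. \<sigma> permutes {..<n}} (permutations_of_set {..<n})"
  unfolding bij_betw_def
proof
  let ?A = "{\<sigma>. \<sigma> permutes {..<n}}"
  show inj: "inj_on (\<lambda>\<sigma>. map \<sigma> [0..<n]) ?A"
  proof (rule inj_onI)
    fix \<sigma> \<tau> assume *: "\<sigma> \<in> ?A" "\<tau> \<in> ?A" "map \<sigma> [0..<n] = map \<tau> [0..<n]"
    show "\<sigma> = \<tau>"
    proof
      fix i show "\<sigma> i = \<tau> i"
        using * by (cases "i < n") (auto simp: permutes_not_in)
    qed
  qed
  have "(\<lambda>\<sigma>. map \<sigma> [0..<n]) ` ?A \<subseteq> permutations_of_set {..<n}"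
    by (auto simp: permutes_image distinct_map atLeast0LessThan permutes_inj_on intro!: permutations_of_setI)
  moreover have "card ((\<lambda>\<sigma>. map \<sigma> [0..<n]) ` ?A) = card (permutations_of_set {..<n})"
    by (simp add: card_image[OF inj] card_permutations[of _ n])
  ultimately show "(\<lambda>\<sigma>. map \<sigma> [0..<n]) ` ?A = permutations_of_set {..<n}"
    by (intro card_subset_eq) auto
qed

lemma mean_score_permutes:
  "mean_score c m n = (\<Sum>\<sigma> | \<sigma> permutes {..<n}. score c m (map (\<lambda>i. real (\<sigma> i)) [0..<n])) / fact n"
proof -
  have inj: "inj_on (map real) A" for A
    by (simp add: inj_on_def inj_map_eq_map[OF inj_of_nat])
  have "mean_score c m n = (\<Sum>xs\<in>permutations_of_set {..<n}. score c m (map real xs)) / fact n"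
    by (simp add: mean_score_def perm_mean_def permutations_of_set_image_inj inj_on_of_nat
        sum.reindex inj card_image)
  also have "(\<Sum>xs\<in>permutations_of_set {..<n}. score c m (map real xs)) =
      (\<Sum>\<sigma> | \<sigma> permutes {..<n}. score c m (map (\<lambda>i. real (\<sigma> i)) [0..<n]))"
    using sum.reindex_bij_betw[OF bij_betw_permutes_permutations[of n], of "\<lambda>xs. score c m (map real xs)"]
    by (simp add: comp_def)
  finally show ?thesis .
qed

section \<open>The relative order of a sample\<close>

definition same_order :: "nat \<Rightarrow> (nat \<Rightarrow> 'b::linorder) \<Rightarrow> (nat \<Rightarrow> 'c::linorder) \<Rightarrow> bool" where
  "same_order n x y \<longleftrightarrow> (\<forall>i<n. \<forall>j<n. x i < x j \<longleftrightarrow> y i < y j)"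

lemma permutes_rank:
  assumes "\<sigma> permutes {..<n}" "i < n"
  shows "card {j. j < n \<and> \<sigma> j < \<sigma> i} = \<sigma> i"
proof -
  have "\<sigma> ` {j. j < n \<and> \<sigma> j < \<sigma> i} = {..<\<sigma> i}"
  proof (intro equalityI subsetI)
    fix k assume "k \<in> {..<\<sigma> i}"
    moreover have "\<sigma> i < n" using assms permutes_in_image[of \<sigma> "{..<n}" i] by simp
    ultimately have "k \<in> \<sigma> ` {..<n}" using permutes_image[OF assms(1)] by simp
    then show "k \<in> \<sigma> ` {j. j < n \<and> \<sigma> j < \<sigma> i}" using \<open>k \<in> {..<\<sigma> i}\<close> by auto
  qed auto
  then have "card (\<sigma> ` {j. j < n \<and> \<sigma> j < \<sigma> i}) = \<sigma> i" by simp
  then show ?thesis by (simp add: card_image permutes_inj_on[OF assms(1)])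
qed

text \<open>The only candidate is the rank function, since by \<open>permutes_rank\<close> the value
  of a permutation at \<open>i\<close> is the number of indices with smaller value.\<close>

lemma ex1_same_order:
  fixes x :: "nat \<Rightarrow> 'b::linorder"
  assumes "inj_on x {..<n}"
  shows "\<exists>!\<sigma>. \<sigma> permutes {..<n} \<and> same_order n x \<sigma>"
proof -
  define \<rho> where "\<rho> = (\<lambda>i. if i < n then card {j. j < n \<and> x j < x i} else i)"
  have mono: "\<rho> i < \<rho> j" if "i < n" "j < n" "x i < x j" for i j
    using that by (auto simp: \<rho>_def intro!: psubset_card_mono)
  have order: "x i < x j \<longleftrightarrow> \<rho> i < \<rho> j" if "i < n" "j < n" for i j
    using mono[OF that] mono[OF that(2,1)] by (cases "x i" "x j" rule: linorder_cases)
      (auto dest: inj_onD[OF assms] simp: that)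
  have "\<rho> permutes {..<n}"
  proof (rule bij_imp_permutes)
    have inj: "inj_on \<rho> {..<n}"
    proof (rule inj_onI)
      fix i j assume "i \<in> {..<n}" "j \<in> {..<n}" "\<rho> i = \<rho> j"
      then have "\<not> x i < x j" "\<not> x j < x i" using order by auto
      then have "x i = x j" by simp
      then show "i = j" using assms \<open>i \<in> _\<close> \<open>j \<in> _\<close> by (auto dest: inj_onD)
    qed
    have "\<rho> i < n" if "i < n" for i
    proof -
      have "card {j. j < n \<and> x j < x i} < card {..<n}"
        using that by (intro psubset_card_mono) auto
      then show ?thesis using that by (simp add: \<rho>_def)
    qed
    then have "\<rho> ` {..<n} \<subseteq> {..<n}" by auto
    then show "bij_betw \<rho> {..<n} {..<n}" using inj by (simp add: bij_betw_def endo_inj_surj)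
  qed (simp add: \<rho>_def)
  moreover have "\<sigma> = \<rho>" if "\<sigma> permutes {..<n}" "same_order n x \<sigma>" for \<sigma>
  proof
    fix i
    show "\<sigma> i = \<rho> i"
    proof (cases "i < n")
      case True
      then have "{j. j < n \<and> x j < x i} = {j. j < n \<and> \<sigma> j < \<sigma> i}"
        using \<open>same_order n x \<sigma>\<close> by (auto simp: same_order_def)
      with True show ?thesis
        by (simp only: \<rho>_def if_True permutes_rank[OF \<open>\<sigma> permutes _\<close>])
    next
      case False
      then show ?thesis using permutes_not_in[OF \<open>\<sigma> permutes _\<close>, of i] by (simp add: \<rho>_def)
    qed
  qed
  moreover have "same_order n x \<rho>" unfolding same_order_def using order by blast
  ultimately show ?thesis by blast
qed

lemma score_eq_protected_fraction:
  assumes "xs \<noteq> []"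
  shows "score c m xs = real (length (nodes (search_tree m xs))) * (protected_fraction (search_tree m xs) - c)"
proof -
  have "(\<Sum>t\<leftarrow>ts. of_bool (two_protected t) - c) = real (length (filter two_protected ts)) - c * real (length ts)" for ts
    by (induction ts) (auto simp: algebra_simps)
  moreover have "nodes (search_tree m xs) \<noteq> []" by (cases "search_tree m xs") simp
  ultimately show ?thesis using assms by (simp add: score_def protected_fraction_def right_diff_distrib)
qed

context prob_space
begin

lemma indep_sets_reindex:
  assumes "indep_sets F J" "inj_on f I" "f ` I \<subseteq> J"
  shows "indep_sets (\<lambda>i. F (f i)) I"
proof (rule indep_setsI)
  show "F (f i) \<subseteq> events" if "i \<in> I" for i
    using assms that by (auto simp: indep_sets_def)
next
  fix A K assume K: "K \<noteq> {}" "K \<subseteq> I" "finite K" "\<forall>i\<in>K. A i \<in> F (f i)"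
  have inj: "inj_on f K" using assms(2) K(2) by (rule inj_on_subset)
  \<comment> \<open>The family \<open>A\<close> on \<open>K\<close> is transported to the image of
    \<open>K\<close> along the inverse of \<open>f\<close>.\<close>
  have "prob (\<Inter>j\<in>f ` K. A (the_inv_into K f j)) = (\<Prod>j\<in>f ` K. prob (A (the_inv_into K f j)))"
    using assms K inj by (intro indep_setsD[OF assms(1)]) (auto simp: the_inv_into_f_f)
  then show "prob (\<Inter>i\<in>K. A i) = (\<Prod>i\<in>K. prob (A i))"
    using inj by (simp add: prod.reindex the_inv_into_f_f cong: INF_cong prod.cong)
qed

lemma indep_vars_reindex:
  assumes "indep_vars (\<lambda>_. N) X J" "inj_on f I" "f ` I \<subseteq> J"
  shows "indep_vars (\<lambda>_. N) (\<lambda>i. X (f i)) I"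
  using assms indep_sets_reindex[OF _ assms(2,3)] unfolding indep_vars_def2 by blast

context
  fixes X :: "nat \<Rightarrow> 'a \<Rightarrow> real"
  assumes indep: "indep_vars (\<lambda>_. borel) X UNIV"
    and ident: "\<And>i. distr M borel (X i) = distr M borel (X 0)"
    and cont: "continuous_on UNIV (cdf (distr M borel (X 0)))"
begin

lemma X_measurable [measurable]: "X i \<in> borel_measurable M"
  using indep by (auto simp: indep_vars_def)

text \<open>A continuous distribution function leaves no atoms, so the diagonal is a null set for
  the product law of two independent keys.\<close>

lemma AE_neq:
  assumes "i \<noteq> j"
  shows "AE \<omega> in M. X i \<omega> \<noteq> X j \<omega>"
proof -
  define D where "D = distr M borel (X 0)"
  interpret D: prob_space D unfolding D_def by (rule prob_space_distr) simp
  interpret D: real_distribution D by standard (simp add: D_def)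
  interpret P: pair_sigma_finite D D by standard
  have sing: "emeasure D {x} = 0" for x
  proof -
    have "isCont (cdf D) x" using cont by (simp add: D_def continuous_on_eq_continuous_at)
    then show ?thesis using D.isCont_cdf[of x] by (simp add: D.emeasure_eq_measure)
  qed
  \<comment> \<open>The pair is viewed as a subfamily indexed by \<open>bool\<close>, the form in
    which \<open>indep_var\<close> is defined.\<close>
  have "indep_vars (\<lambda>_. borel) (\<lambda>b. X (case_bool i j b)) UNIV"
    using assms by (intro indep_vars_reindex[OF indep]) (auto simp: inj_on_def split: bool.splits)
  also have "?this \<longleftrightarrow> indep_var borel (X i) borel (X j)"
    unfolding indep_var_def by (intro indep_vars_cong) (auto split: bool.split)
  finally have "indep_var borel (X i) borel (X j)" .
  then have joint: "distr M (borel \<Otimes>\<^sub>M borel) (\<lambda>\<omega>. (X i \<omega>, X j \<omega>)) = D \<Otimes>\<^sub>M D"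
    using indep_var_distribution_eq[of borel "X i" borel "X j"] ident[of i] ident[of j] by (simp add: D_def)
  have "AE z in D \<Otimes>\<^sub>M D. fst z \<noteq> snd z"
  proof (rule P.AE_pair_measure)
    have "AE y in D. y \<noteq> x" for x
      using sing[of x] by (intro AE_I[of _ _ "{x}"]) auto
    then show "AE x in D. AE y in D. fst (x, y) \<noteq> snd (x, y)" by (simp add: eq_commute)
  qed measurable
  then show ?thesis unfolding joint[symmetric] by (subst (asm) AE_distr_iff) auto
qed

lemma AE_inj: "AE \<omega> in M. inj_on (\<lambda>i. X i \<omega>) {..<n}"
proof -
  have "AE \<omega> in M. \<forall>i j. i \<noteq> j \<longrightarrow> X i \<omega> \<noteq> X j \<omega>"
    using AE_neq by (simp add: AE_all_countable)
  then show ?thesis by eventually_elim (auto simp: inj_on_def)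
qed

lemma same_order_events [measurable]: "{\<omega>\<in>space M. same_order n (\<lambda>i. X i \<omega>) y} \<in> events"
  unfolding same_order_def by measurable

text \<open>Exchangeability: permuting the indices of an i.i.d. sample preserves the joint law, and
  \<open>\<sigma>\<close> can be moved into the indices through its inverse.\<close>

lemma prob_same_order:
  assumes "\<sigma> permutes {..<n}"
  shows "prob {\<omega>\<in>space M. same_order n (\<lambda>i. X i \<omega>) \<sigma>} = prob {\<omega>\<in>space M. same_order n (\<lambda>i. X i \<omega>) id}"
\<comment> \<open>The characterisation of independence by product measures is applied below with a
  nonempty index set.\<close>
proof (cases "n = 0")
  case True
  then show ?thesis by (simp add: same_order_def)
next
  case False
  define D where "D = distr M borel (X 0)"
  define I where "I = {..<n}"
  have I: "I \<noteq> {}" using False by (auto simp: I_def)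
  define A where "A = {x\<in>space (\<Pi>\<^sub>M i\<in>I. (borel :: real measure)). same_order n x (id :: nat \<Rightarrow> nat)}"
  have A: "A \<in> sets (\<Pi>\<^sub>M i\<in>I. borel)"
    unfolding A_def same_order_def I_def by measurable
  have law: "prob {\<omega>\<in>space M. same_order n (\<lambda>i. X (\<tau> i) \<omega>) id} = measure (\<Pi>\<^sub>M i\<in>I. D) A"
    if "\<tau> permutes {..<n}" for \<tau>
  proof -
    have "indep_vars (\<lambda>_. borel) (\<lambda>i. X (\<tau> i)) I"
      using permutes_inj_on[OF that] by (intro indep_vars_reindex[OF indep]) auto
    then have "distr M (\<Pi>\<^sub>M i\<in>I. borel) (\<lambda>\<omega>. \<lambda>i\<in>I. X (\<tau> i) \<omega>) = (\<Pi>\<^sub>M i\<in>I. distr M borel (X (\<tau> i)))"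
      using indep_vars_iff_distr_eq_PiM[OF I, of "\<lambda>i. X (\<tau> i)" "\<lambda>_. borel"] by simp
    then have eq: "distr M (\<Pi>\<^sub>M i\<in>I. borel) (\<lambda>\<omega>. \<lambda>i\<in>I. X (\<tau> i) \<omega>) = (\<Pi>\<^sub>M i\<in>I. D)"
      using ident[of "\<tau> _"] by (simp add: D_def)
    have "prob {\<omega>\<in>space M. same_order n (\<lambda>i. X (\<tau> i) \<omega>) id} =
        prob ((\<lambda>\<omega>. \<lambda>i\<in>I. X (\<tau> i) \<omega>) -` A \<inter> space M)"
      by (intro arg_cong[where f = prob]) (auto simp: A_def space_PiM same_order_def I_def)
    also have "\<dots> = measure (\<Pi>\<^sub>M i\<in>I. D) A"
      unfolding eq[symmetric] by (intro measure_distr[symmetric] A) measurable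
    finally show ?thesis .
  qed
  have inv: "inv \<sigma> permutes {..<n}" using assms by (rule permutes_inv)
  have "same_order n x \<sigma> \<longleftrightarrow> same_order n (\<lambda>i. x (inv \<sigma> i)) id" for x :: "nat \<Rightarrow> real"
  proof
    assume *: "same_order n x \<sigma>"
    have "inv \<sigma> i < n" if "i < n" for i using permutes_in_image[OF inv, of i] that by simp
    then show "same_order n (\<lambda>i. x (inv \<sigma> i)) id"
      using * by (auto simp: same_order_def permutes_inverses[OF assms])
  next
    assume *: "same_order n (\<lambda>i. x (inv \<sigma> i)) id"
    have "\<sigma> i < n" if "i < n" for i using permutes_in_image[OF assms, of i] that by simp
    then show "same_order n x \<sigma>"
      using * unfolding same_order_def by (metis id_apply permutes_inverses(2)[OF assms])
  qed
  then show ?thesis using law[OF inv] law[OF permutes_id] by simp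
qed

text \<open>Almost surely exactly one of the \<open>fact n\<close> order events occurs, and they are
  equally likely.\<close>

lemma prob_same_order_eq:
  assumes "\<sigma> permutes {..<n}"
  shows "prob {\<omega>\<in>space M. same_order n (\<lambda>i. X i \<omega>) \<sigma>} = 1 / fact n"
proof -
  let ?P = "{\<sigma>. \<sigma> permutes {..<n}}"
  let ?E = "\<lambda>\<sigma>. {\<omega>\<in>space M. same_order n (\<lambda>i. X i \<omega>) \<sigma>}"
  have fin: "finite ?P" by (simp add: finite_permutations)
  have "AE \<omega> in M. (\<Sum>\<sigma>\<in>?P. indicat_real (?E \<sigma>) \<omega>) = 1"
    using AE_inj[of n] AE_space
  proof eventually_elim
    case (elim \<omega>)
    then obtain \<sigma> where \<sigma>: "\<And>\<tau>. \<tau> permutes {..<n} \<and> same_order n (\<lambda>i. X i \<omega>) \<tau> \<longleftrightarrow> \<tau> = \<sigma>"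
      using ex1_same_order[of "\<lambda>i. X i \<omega>" n] by metis
    have "(\<Sum>\<tau>\<in>?P. indicat_real (?E \<tau>) \<omega>) = (\<Sum>\<tau>\<in>?P. if \<tau> = \<sigma> then 1 else 0)"
      using \<sigma> elim by (intro sum.cong) (auto simp: indicator_def)
    also have "\<dots> = 1" using \<sigma>[of \<sigma>] fin by simp
    finally show ?case .
  qed
  then have "expectation (\<lambda>\<omega>. \<Sum>\<sigma>\<in>?P. indicat_real (?E \<sigma>) \<omega>) = 1"
    by (subst integral_cong_AE[where g = "\<lambda>_. 1"]) (auto simp: prob_space)
  moreover have "expectation (\<lambda>\<omega>. \<Sum>\<sigma>\<in>?P. indicat_real (?E \<sigma>) \<omega>) = (\<Sum>\<tau>\<in>?P. prob (?E \<tau>))"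
    by (subst Bochner_Integration.integral_sum) (auto simp: less_top[symmetric])
  moreover have "(\<Sum>\<tau>\<in>?P. prob (?E \<tau>)) = (\<Sum>\<tau>\<in>?P. prob (?E \<sigma>))"
    by (intro sum.cong refl trans[OF prob_same_order prob_same_order[symmetric]]) (use assms in auto)
  ultimately show ?thesis using fin by (simp add: card_permutations[of _ n] field_simps)
qed

text \<open>\<open>Y\<close> is a finite combination of indicators of order events. It stands in for
  the score of the sample, whose measurability is not established separately.\<close>

lemma expectation_score:
  assumes "m \<ge> 2"
  shows "\<exists>Y. integrable M Y \<and> expectation Y = mean_score c m n \<and>
    (AE \<omega> in M. Y \<omega> = score c m (map (\<lambda>i. X i \<omega>) [0..<n]))"
proof -
  let ?P = "{\<sigma>. \<sigma> permutes {..<n}}"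
  let ?E = "\<lambda>\<sigma>. {\<omega>\<in>space M. same_order n (\<lambda>i. X i \<omega>) \<sigma>}"
  let ?s = "\<lambda>\<sigma>. score c m (map (\<lambda>i. real (\<sigma> i)) [0..<n])"
  define Y where "Y = (\<lambda>\<omega>. \<Sum>\<sigma>\<in>?P. ?s \<sigma> * indicat_real (?E \<sigma>) \<omega>)"
  have fin: "finite ?P" by (simp add: finite_permutations)
  have "integrable M Y" unfolding Y_def by (intro Bochner_Integration.integrable_sum integrable_mult_right) (simp add: less_top[symmetric])
  moreover have "expectation Y = mean_score c m n"
    unfolding Y_def mean_score_permutes
    by (subst Bochner_Integration.integral_sum)
      (auto simp: less_top[symmetric] prob_same_order_eq sum_divide_distrib intro!: sum.cong)
  moreover have "AE \<omega> in M. Y \<omega> = score c m (map (\<lambda>i. X i \<omega>) [0..<n])"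
    using AE_inj[of n] AE_space
  proof eventually_elim
    case (elim \<omega>)
    then obtain \<sigma> where \<sigma>: "\<And>\<tau>. \<tau> permutes {..<n} \<and> same_order n (\<lambda>i. X i \<omega>) \<tau> \<longleftrightarrow> \<tau> = \<sigma>"
      using ex1_same_order[of "\<lambda>i. X i \<omega>" n] by metis
    have "Y \<omega> = (\<Sum>\<tau>\<in>?P. if \<tau> = \<sigma> then ?s \<sigma> else 0)"
      unfolding Y_def using \<sigma> elim by (intro sum.cong) (auto simp: indicator_def)
    also have "\<dots> = ?s \<sigma>" using \<sigma>[of \<sigma>] fin by simp
    also have "\<dots> = score c m (map (\<lambda>i. X i \<omega>) [0..<n])"
      using \<sigma>[of \<sigma>] by (intro score_order_invariant assms) (auto simp: same_order_def)
    finally show ?case .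
  qed
  ultimately show ?thesis by blast
qed

text \<open>Dominated convergence with the constant bound \<open>1 + \<bar>c\<bar>\<close>. The
  denominator \<open>n + 1\<close> avoids division by zero and fits the mass condition of
  \<open>weighted_toll_sums_zero\<close>.\<close>

lemma mean_score_sublinear:
  assumes m: "m \<ge> 2"
    and lim: "AE \<omega> in M. (\<lambda>n. protected_fraction (search_tree m (map (\<lambda>i. X i \<omega>) [0..<n]))) \<longlonglongrightarrow> c"
  shows "(\<lambda>n. mean_score c m n / real (n + 1)) \<longlonglongrightarrow> 0"
proof -
  obtain Y where Y: "\<And>n. integrable M (Y n)" "\<And>n. expectation (Y n) = mean_score c m n"
    "\<And>n. AE \<omega> in M. Y n \<omega> = score c m (map (\<lambda>i. X i \<omega>) [0..<n])"
    using expectation_score[OF m] by metis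
  have AE_Y: "AE \<omega> in M. \<forall>n. Y n \<omega> = score c m (map (\<lambda>i. X i \<omega>) [0..<n])"
    using Y(3) by (simp add: AE_all_countable)
  have bound: "\<bar>score c m xs / real (length xs + 1)\<bar> \<le> \<bar>protected_fraction (search_tree m xs) - c\<bar>" for xs
  proof (cases "xs = []")
    case False
    have "\<bar>score c m xs / real (length xs + 1)\<bar> =
        real (length (nodes (search_tree m xs))) / real (length xs + 1) * \<bar>protected_fraction (search_tree m xs) - c\<bar>"
      by (simp add: score_eq_protected_fraction[OF False] abs_mult)
    also have "\<dots> \<le> 1 * \<bar>protected_fraction (search_tree m xs) - c\<bar>"
      using length_nodes_search_tree[OF m False] by (intro mult_right_mono) auto
    finally show ?thesis by simp
  qed (simp add: score_def)
  have frac: "\<bar>protected_fraction t\<bar> \<le> 1" for t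
    using length_filter_le[of two_protected "nodes t"] by (auto simp: protected_fraction_def divide_le_eq_1)
  have "(\<lambda>n. expectation (\<lambda>\<omega>. Y n \<omega> / real (n + 1))) \<longlonglongrightarrow> expectation (\<lambda>_. 0 :: real)"
  proof (rule integral_dominated_convergence[where w = "\<lambda>_. 1 + \<bar>c\<bar>"])
    show "AE \<omega> in M. (\<lambda>n. Y n \<omega> / real (n + 1)) \<longlonglongrightarrow> 0"
      using AE_Y lim
    proof eventually_elim
      case (elim \<omega>)
      show ?case
      proof (rule Lim_null_comparison)
        show "\<forall>\<^sub>F n in sequentially. norm (Y n \<omega> / real (n + 1)) \<le>
            \<bar>protected_fraction (search_tree m (map (\<lambda>i. X i \<omega>) [0..<n])) - c\<bar>"
          using elim(1) bound[of "map (\<lambda>i. X i \<omega>) [0..<_]"] by (simp del: abs_divide)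
        show "(\<lambda>n. \<bar>protected_fraction (search_tree m (map (\<lambda>i. X i \<omega>) [0..<n])) - c\<bar>) \<longlonglongrightarrow> 0"
          using elim(2) by (intro tendsto_rabs_zero) (simp add: LIM_zero)
      qed
    qed
    show "AE \<omega> in M. norm (Y n \<omega> / real (n + 1)) \<le> 1 + \<bar>c\<bar>" for n
      using AE_Y
    proof eventually_elim
      case (elim \<omega>)
      have "norm (Y n \<omega> / real (n + 1)) \<le>
          \<bar>protected_fraction (search_tree m (map (\<lambda>i. X i \<omega>) [0..<n])) - c\<bar>"
        using elim bound[of "map (\<lambda>i. X i \<omega>) [0..<n]"] by (simp del: abs_divide)
      also have "\<dots> \<le> 1 + \<bar>c\<bar>"
        using frac[of "search_tree m (map (\<lambda>i. X i \<omega>) [0..<n])"] by linarith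
      finally show ?case .
    qed
  qed (use Y(1) in auto)
  then show ?thesis using Y by simp
qed

end

end

section \<open>Series over compositions\<close>

text \<open>
  A Toeplitz argument: the partial sums are \<open>\<Sum>\<^sub>k t\<^sub>K\<^sub>k a\<^sub>k\<close> with the nonnegative tails \<open>t\<^sub>K\<^sub>k\<close> of the
  series in \<open>weights\<close>, and \<open>\<Sum>\<^sub>k t\<^sub>K\<^sub>k (k + 1) \<le> r\<close> for all \<open>K\<close> by \<open>mass\<close>.
\<close>

lemma weighted_toll_sums_zero:
  fixes a b :: "nat \<Rightarrow> real" and q :: "nat \<Rightarrow> nat \<Rightarrow> real" and r :: nat
  defines "w \<equiv> \<lambda>n. 1 / (real (n + 1) * real (n + 2))"
  assumes nonneg: "\<And>n k. 0 \<le> q n k"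
    and supp: "\<And>n k. n < k \<Longrightarrow> q n k = 0"
    and rec: "\<And>n. a n = b n + (\<Sum>k\<le>n. q n k * a k)"
    and mass: "\<And>n. (\<Sum>k\<le>n. q n k * real (k + 1)) = (if n < r then 0 else real (n + 1))"
    and weights: "\<And>k. (\<lambda>n. w n * q n k) sums w k"
    and lim: "(\<lambda>n. a n / real (n + 1)) \<longlonglongrightarrow> 0"
  shows "(\<lambda>n. w n * b n) sums 0"
proof -
  define t where "t = (\<lambda>K k. w k - (\<Sum>n<K. w n * q n k))"
  have w: "0 \<le> w n" for n by (simp add: w_def)
  have t_nonneg: "0 \<le> t K k" for K k
  proof -
    have "(\<Sum>n<K. w n * q n k) \<le> suminf (\<lambda>n. w n * q n k)"
      using weights[of k] w nonneg by (intro sum_le_suminf) (auto simp: sums_iff)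
    then show ?thesis using weights[of k] by (simp add: t_def sums_iff)
  qed
  have t_lim: "(\<lambda>K. t K k) \<longlonglongrightarrow> 0" for k
    using weights[of k] unfolding t_def sums_def by (auto intro!: tendsto_eq_intros)
  \<comment> \<open>Kept general in \<open>f\<close>: it is applied to \<open>a\<close> and to
    \<open>k + 1\<close>.\<close>
  have swap: "(\<Sum>n<K. w n * (f n - (\<Sum>k\<le>n. q n k * f k))) = (\<Sum>k<K. t K k * f k)" for f K
  proof -
    have "(\<Sum>k\<le>n. q n k * f k) = (\<Sum>k<K. q n k * f k)" if "n < K" for n
      using that supp by (intro sum.mono_neutral_left) auto
    then have "(\<Sum>n<K. w n * (f n - (\<Sum>k\<le>n. q n k * f k))) =
        (\<Sum>n<K. w n * f n) - (\<Sum>n<K. \<Sum>k<K. w n * q n k * f k)"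
      by (simp add: right_diff_distrib sum_subtractf sum_distrib_left mult.assoc)
    also have "(\<Sum>n<K. \<Sum>k<K. w n * q n k * f k) = (\<Sum>k<K. (\<Sum>n<K. w n * q n k) * f k)"
      by (subst sum.swap) (simp add: sum_distrib_right)
    finally show ?thesis by (simp add: t_def left_diff_distrib sum_subtractf)
  qed
  \<comment> \<open>By \<open>mass\<close> only the terms with \<open>n < r\<close> survive, each at
    most \<open>w n * (n + 1) \<le> 1\<close>.\<close>
  have total: "(\<Sum>k<K. t K k * real (k + 1)) \<le> real r" for K
  proof -
    have "(\<Sum>k<K. t K k * real (k + 1)) = (\<Sum>n<K. w n * (real (n + 1) - (if n < r then 0 else real (n + 1))))"
      unfolding swap[symmetric] mass ..
    also have "\<dots> \<le> (\<Sum>n<K. of_bool (n < r))"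
    proof (rule sum_mono)
      fix n
      have "w n * real (n + 1) \<le> 1" by (simp add: w_def)
      then show "w n * (real (n + 1) - (if n < r then 0 else real (n + 1))) \<le> of_bool (n < r)" by simp
    qed
    also have "\<dots> = real (card ({..<K} \<inter> {n. n < r}))" by simp
    also have "card ({..<K} \<inter> {n. n < r}) \<le> card {..<r}" by (intro card_mono) auto
    finally show ?thesis by simp
  qed
  have b: "b n = a n - (\<Sum>k\<le>n. q n k * a k)" for n using rec[of n] by simp
  have "(\<lambda>K. \<Sum>k<K. t K k * a k) \<longlonglongrightarrow> 0"
  proof (rule LIMSEQ_I)
    fix e :: real assume "e > 0"
    \<comment> \<open>With this \<open>d\<close>, the indices beyond \<open>N\<close> contribute at
      most \<open>d * r \<le> e / 2\<close> by \<open>total\<close>; the first \<open>N\<close>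
      indices contribute less than \<open>e / 2\<close> for large \<open>K\<close>.\<close>
    define d where "d = e / (2 * (real r + 1))"
    have d: "d > 0" using \<open>e > 0\<close> by (simp add: d_def)
    have dr: "d * real r \<le> e / 2" using \<open>e > 0\<close> by (simp add: d_def field_simps)
    obtain N where N: "\<And>k. k \<ge> N \<Longrightarrow> \<bar>a k / real (k + 1)\<bar> < d"
      using LIMSEQ_D[OF lim d] by auto
    have "(\<lambda>K. \<Sum>k<N. t K k * \<bar>a k\<bar>) \<longlonglongrightarrow> (\<Sum>k<N. 0 * \<bar>a k\<bar>)"
      by (intro tendsto_intros t_lim)
    then have "(\<lambda>K. \<Sum>k<N. t K k * \<bar>a k\<bar>) \<longlonglongrightarrow> 0" by simp
    from LIMSEQ_D[OF this, of "e / 2"] \<open>e > 0\<close>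
    obtain K0 where K0: "\<And>K. K \<ge> K0 \<Longrightarrow> \<bar>\<Sum>k<N. t K k * \<bar>a k\<bar>\<bar> < e / 2" by auto
    have "norm ((\<Sum>k<K. t K k * a k) - 0) < e" if "K \<ge> K0" for K
    proof -
      have term_le: "t K k * \<bar>a k\<bar> \<le> t K k * \<bar>a k\<bar> * of_bool (k < N) + d * (t K k * real (k + 1))" for k
      proof (cases "k < N")
        case False
        then have "\<bar>a k\<bar> \<le> d * real (k + 1)" using N[of k] by (simp add: field_simps)
        then show ?thesis using False mult_left_mono[of "\<bar>a k\<bar>" "d * real (k + 1)" "t K k"] t_nonneg
          by (simp add: mult_ac)
      qed (use d t_nonneg in auto)
      have "\<bar>\<Sum>k<K. t K k * a k\<bar> \<le> (\<Sum>k<K. t K k * \<bar>a k\<bar>)"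
        using t_nonneg by (intro order_trans[OF sum_abs]) (simp add: abs_mult)
      also have "\<dots> \<le> (\<Sum>k<K. t K k * \<bar>a k\<bar> * of_bool (k < N)) + d * (\<Sum>k<K. t K k * real (k + 1))"
        unfolding sum_distrib_left sum.distrib[symmetric] by (intro sum_mono term_le)
      also have "(\<Sum>k<K. t K k * \<bar>a k\<bar> * of_bool (k < N)) = (\<Sum>k\<in>{..<K} \<inter> {..<N}. t K k * \<bar>a k\<bar>)"
        by (intro sum.mono_neutral_cong_right) auto
      also have "\<dots> \<le> (\<Sum>k<N. t K k * \<bar>a k\<bar>)"
        using t_nonneg by (intro sum_mono2) auto
      also have "\<dots> < e / 2" using K0[OF that] by simp
      also have "d * (\<Sum>k<K. t K k * real (k + 1)) \<le> d * real r"
        using d total by (intro mult_left_mono) auto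
      finally show ?thesis using dr by simp
    qed
    then show "\<exists>K0. \<forall>K\<ge>K0. norm ((\<Sum>k<K. t K k * a k) - 0) < e" by blast
  qed
  then show ?thesis unfolding sums_def swap[symmetric] b .
qed

section \<open>Generating functions of compositions\<close>

lemma compositions_0: "compositions 0 s = (if s = 0 then {[]} else {})"
  by (auto simp: compositions_def)

lemma sum_compositions_Suc:
  "(\<Sum>ks\<in>compositions (Suc m) s. h ks) = (\<Sum>j\<le>s. \<Sum>ks\<in>compositions m (s - j). h (j # ks))"
proof -
  have "(\<Sum>ks\<in>compositions (Suc m) s. h ks) =
      (\<Sum>(j, ks)\<in>(SIGMA j:{..s}. compositions m (s - j)). h (j # ks))"
    by (rule sum.reindex_bij_witness[where j = "\<lambda>ks. (hd ks, tl ks)" and i = "\<lambda>(j, ks). j # ks"])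
      (auto simp: compositions_def length_Suc_conv)
  then show ?thesis by (simp add: sum.Sigma)
qed

text \<open>The coefficients are \<open>m\<close>-fold convolutions of \<open>f\<close>, so the
  series is an \<open>m\<close>-th power; nonnegativity provides absolute convergence for the Cauchy
  products.\<close>

lemma prod_compositions_sums:
  fixes f :: "nat \<Rightarrow> real" and z :: real
  assumes "\<And>k. 0 \<le> f k" "0 \<le> z" "(\<lambda>k. f k * z ^ k) sums F"
  shows "(\<lambda>s. (\<Sum>ks\<in>compositions m s. \<Prod>k\<leftarrow>ks. f k) * z ^ s) sums F ^ m"
proof (induction m)
  case 0
  have "(\<lambda>s. (\<Sum>ks\<in>compositions 0 s. \<Prod>k\<leftarrow>ks. f k) * z ^ s) = (\<lambda>s. if s = 0 then 1 else 0)"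
    by (auto simp: compositions_0)
  then show ?case using sums_single[of 0 "\<lambda>_. 1 :: real"] by simp
next
  case (Suc m)
  let ?c = "\<lambda>s. (\<Sum>ks\<in>compositions m s. \<Prod>k\<leftarrow>ks. f k)"
  have c: "0 \<le> ?c s" for s using assms by (intro sum_nonneg prod_list_nonneg) auto
  have "(\<lambda>s. \<Sum>j\<le>s. (f j * z ^ j) * (?c (s - j) * z ^ (s - j))) sums (F * F ^ m)"
    using Cauchy_product_sums[of "\<lambda>k. f k * z ^ k" "\<lambda>s. ?c s * z ^ s"] assms Suc c
    by (simp add: sums_iff abs_mult)
  moreover have "(\<Sum>j\<le>s. (f j * z ^ j) * (?c (s - j) * z ^ (s - j))) =
      (\<Sum>ks\<in>compositions (Suc m) s. \<Prod>k\<leftarrow>ks. f k) * z ^ s" for s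
  proof -
    have "(f j * z ^ j) * (?c (s - j) * z ^ (s - j)) = (\<Sum>ks\<in>compositions m (s - j). \<Prod>k\<leftarrow>j # ks. f k) * z ^ s"
      if "j \<le> s" for j
    proof -
      have "z ^ s = z ^ j * z ^ (s - j)" using that by (simp flip: power_add)
      then show ?thesis by (simp add: sum_distrib_left mult_ac)
    qed
    then show ?thesis
      by (simp only: sum_compositions_Suc sum_distrib_right[of _ "{..s}"]) (auto intro!: sum.cong)
  qed
  ultimately show ?case by simp
qed

lemma card_compositions_sums:
  fixes z :: real
  assumes "0 \<le> z" "z < 1"
  shows "(\<lambda>s. card (compositions m s) * z ^ s) sums (1 / (1 - z)) ^ m"
proof -
  have "(\<lambda>k. 1 * z ^ k) sums (1 / (1 - z))" using geometric_sums[of z] assms by simp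
  from prod_compositions_sums[OF _ assms(1) this, of m] show ?thesis by (simp add: map_replicate_const)
qed

text \<open>One of the \<open>m\<close> parts is marked and equals \<open>k\<close>, which gives
  \<open>z ^ k\<close>; each of the other \<open>m - 1\<close> parts gives a geometric
  series.\<close>

lemma count_compositions_sums:
  fixes z :: real
  assumes "0 \<le> z" "z < 1"
  shows "(\<lambda>s. (\<Sum>ks\<in>compositions m s. real (count_list ks k)) * z ^ s) sums
    (real m * z ^ k * (1 / (1 - z)) ^ (m - 1))"
proof (induction m)
  case 0
  then show ?case by (simp add: compositions_0 if_distrib[of "sum _"] cong: if_cong)
next
  case (Suc m)
  let ?c = "\<lambda>s. real (card (compositions m s)) * z ^ s"
  let ?N = "\<lambda>m s. \<Sum>ks\<in>compositions m s. real (count_list ks k)"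
  let ?g = "\<lambda>j. if j = k then z ^ j else 0"
  have geo: "(\<lambda>j. z ^ j) sums (1 / (1 - z))" using geometric_sums[of z] assms by simp
  have N: "0 \<le> ?N m s" for s by (simp add: sum_nonneg)
  \<comment> \<open>The first series counts an initial part equal to \<open>k\<close>, the second
    the occurrences of \<open>k\<close> among the later parts.\<close>
  have 1: "(\<lambda>s. \<Sum>j\<le>s. ?g j * ?c (s - j)) sums (z ^ k * (1 / (1 - z)) ^ m)"
    using Cauchy_product_sums[of ?g ?c] card_compositions_sums[OF assms, of m] sums_single[of k "\<lambda>j. z ^ j"] assms
    by (simp add: sums_iff abs_mult if_distrib[of abs] cong: if_cong)
  have 2: "(\<lambda>s. \<Sum>j\<le>s. z ^ j * (?N m (s - j) * z ^ (s - j))) sums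
      (1 / (1 - z) * (real m * z ^ k * (1 / (1 - z)) ^ (m - 1)))"
    using Cauchy_product_sums[of "\<lambda>j. z ^ j" "\<lambda>s. ?N m s * z ^ s"] Suc geo assms N
    by (simp add: sums_iff abs_mult)
  have "(\<Sum>j\<le>s. ?g j * ?c (s - j)) + (\<Sum>j\<le>s. z ^ j * (?N m (s - j) * z ^ (s - j))) = ?N (Suc m) s * z ^ s" for s
  proof -
    have "?g j * ?c (s - j) + z ^ j * (?N m (s - j) * z ^ (s - j)) =
        (\<Sum>ks\<in>compositions m (s - j). real (count_list (j # ks) k)) * z ^ s" if "j \<le> s" for j
    proof -
      have "z ^ s = z ^ j * z ^ (s - j)" using that by (simp flip: power_add)
      then show ?thesis by (auto simp add: algebra_simps sum.distrib)
    qed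
    then show ?thesis
      by (simp only: sum.distrib[symmetric] sum_compositions_Suc sum_distrib_right) (auto intro!: sum.cong)
  qed
  then have "(\<lambda>s. ?N (Suc m) s * z ^ s) sums
      (z ^ k * (1 / (1 - z)) ^ m + 1 / (1 - z) * (real m * z ^ k * (1 / (1 - z)) ^ (m - 1)))"
    using sums_add[OF 1 2] by simp
  \<comment> \<open>The truncated exponent \<open>m - 1\<close> does no harm at
    \<open>m = 0\<close>, where its term has the factor \<open>real m\<close>.\<close>
  also have "z ^ k * (1 / (1 - z)) ^ m + 1 / (1 - z) * (real m * z ^ k * (1 / (1 - z)) ^ (m - 1))
      = real (Suc m) * z ^ k * (1 / (1 - z)) ^ (Suc m - 1)"
    by (cases m) (simp_all add: algebra_simps)
  finally show ?case .
qed

section \<open>Beta integrals\<close>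

lemma has_integral_beta:
  "((\<lambda>z. z ^ s * (1 - z) ^ m) has_integral (fact s * fact m / fact (s + m + 1) :: real)) {0..1}"
proof -
  have "((\<lambda>t. t powr (real (s + 1) - 1) * (1 - t) powr (real (m + 1) - 1)) has_integral
      Beta (real (s + 1)) (real (m + 1))) {0..1}"
    by (rule has_integral_Beta_real) auto
  \<comment> \<open>The endpoints are dropped because \<open>powr\<close> and natural powers differ
    for base and exponent \<open>0\<close>.\<close>
  then have "((\<lambda>t. t powr (real (s + 1) - 1) * (1 - t) powr (real (m + 1) - 1)) has_integral
      Beta (real (s + 1)) (real (m + 1))) {0<..<1}"
    by (simp add: has_integral_Icc_iff_Ioo)
  then have "((\<lambda>z. z ^ s * (1 - z) ^ m) has_integral Beta (real (s + 1)) (real (m + 1))) {0<..<1}"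
    by (rule has_integral_cong[THEN iffD1, rotated]) (simp add: powr_realpow)
  moreover have "Beta (real (s + 1)) (real (m + 1)) = fact s * fact m / fact (s + m + 1)"
  proof -
    have "real (s + 1) = 1 + real s" "real (m + 1) = 1 + real m"
      "real (s + 1) + real (m + 1) = 1 + real (s + m + 1)" by simp_all
    then show ?thesis unfolding Beta_def by (simp only: Gamma_fact)
  qed
  ultimately show ?thesis by (simp add: has_integral_Icc_iff_Ioo)
qed

text \<open>Integration term by term, by monotone convergence. It works on the open interval, since
  the series is only assumed to converge there.\<close>

lemma sums_beta_weights:
  fixes c :: "nat \<Rightarrow> real" and p :: "real \<Rightarrow> real"
  assumes nonneg: "\<And>s. 0 \<le> c s"
    and sums: "\<And>z. 0 < z \<Longrightarrow> z < 1 \<Longrightarrow> (\<lambda>s. c s * (z ^ s * (1 - z) ^ m)) sums p z"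
    and int: "(p has_integral J) {0..1}"
  shows "(\<lambda>s. c s * (fact s * fact m / fact (s + m + 1))) sums J"
proof -
  let ?S = "{0<..<1::real}"
  let ?f = "\<lambda>K z. \<Sum>s<K. c s * (z ^ s * (1 - z) ^ m)"
  have p: "(p has_integral J) ?S" using int by (simp add: has_integral_Icc_iff_Ioo)
  have f: "(?f K has_integral (\<Sum>s<K. c s * (fact s * fact m / fact (s + m + 1)))) ?S" for K
    using has_integral_beta by (intro has_integral_sum has_integral_mult_right) (auto simp: has_integral_Icc_iff_Ioo)
  have "p integrable_on ?S \<and> (\<lambda>K. integral ?S (?f K)) \<longlonglongrightarrow> integral ?S p"
  proof (rule monotone_convergence_increasing)
    show "?f K integrable_on ?S" for K using f by (rule has_integral_integrable)
    show "?f K z \<le> ?f (Suc K) z" if "z \<in> ?S" for K z using that nonneg by auto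
    show "(\<lambda>K. ?f K z) \<longlonglongrightarrow> p z" if "z \<in> ?S" for z
      using sums[of z] that by (simp add: sums_def)
    have "\<bar>integral ?S (?f K)\<bar> \<le> J" for K
    proof -
      have "0 \<le> integral ?S (?f K)"
        using nonneg by (intro integral_nonneg has_integral_integrable[OF f]) (auto intro!: sum_nonneg)
      moreover have "integral ?S (?f K) \<le> integral ?S p"
      proof (rule integral_le[OF has_integral_integrable[OF f] has_integral_integrable[OF p]])
        fix z assume z: "z \<in> ?S"
        then have "?f K z \<le> (\<Sum>s. c s * (z ^ s * (1 - z) ^ m))"
          using sums[of z] nonneg by (intro sum_le_suminf) (auto simp: sums_iff)
        then show "?f K z \<le> p z" using sums[of z] z by (simp add: sums_iff)
      qed
      ultimately show ?thesis using p by (simp add: integral_unique)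
    qed
    then show "bounded (range (\<lambda>K. integral ?S (?f K)))"
      by (auto simp: bounded_iff intro!: exI[of _ J])
  qed
  then show ?thesis using f p by (simp add: sums_def integral_unique[OF f] integral_unique[OF p])
qed

section \<open>The value of the limit\<close>

text \<open>The integral of \<open>z ^ s * (1 - z) ^ m\<close> over \<open>[0, 1]\<close>, by
  \<open>has_integral_beta\<close>.\<close>

definition beta_weight :: "nat \<Rightarrow> nat \<Rightarrow> real" where
  "beta_weight s m = fact s * fact m / fact (s + m + 1)"

lemma beta_weight_1: "beta_weight k 1 = 1 / (real (k + 1) * real (k + 2))"
  by (simp add: beta_weight_def)

text \<open>For \<open>n = s + r\<close> and \<open>m = Suc r\<close> the left side is the weight of
  \<open>n\<close> divided by the number of compositions of \<open>s\<close> into \<open>m\<close>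
  parts.\<close>

lemma beta_weight_binomial:
  "1 / (real (s + r + 1) * real (s + r + 2)) / real ((s + r) choose r) = beta_weight s (Suc r) / real (Suc r)"
proof -
  have "real ((s + r) choose r) = fact (s + r) / (fact r * fact s)"
    by (subst binomial_fact) auto
  moreover have "fact (s + Suc r + 1) = real (s + r + 2) * (real (s + r + 1) * fact (s + r))"
    by (simp add: algebra_simps)
  moreover have "fact (Suc r) = real (Suc r) * fact r" by simp
  ultimately show ?thesis unfolding beta_weight_def by (simp del: fact_Suc of_nat_Suc add: field_simps)
qed

lemma sum_list_eq_sum_count_list:
  fixes f :: "'b \<Rightarrow> real"
  assumes "set xs \<subseteq> A" "finite A"
  shows "(\<Sum>x\<leftarrow>xs. f x) = (\<Sum>x\<in>A. real (count_list xs x) * f x)"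
  using assms
proof (induction xs)
  case (Cons y ys)
  have "(\<Sum>x\<in>A. real (count_list (y # ys) x) * f x) = (\<Sum>x\<in>A. real (count_list ys x) * f x + (if x = y then f y else 0))"
    by (intro sum.cong) (auto simp: algebra_simps)
  then show ?case using Cons by (simp add: sum.distrib)
qed simp

text \<open>The mean number of children of the root that receive exactly \<open>k\<close> of
  \<open>n\<close> keys; it vanishes as long as the root is not full.\<close>

definition split_weight :: "nat \<Rightarrow> nat \<Rightarrow> nat \<Rightarrow> real" where
  "split_weight m n k = (if n < m - 1 then 0
     else (\<Sum>ks\<in>compositions m (n - (m - 1)). real (count_list ks k)) / (n choose (m - 1)))"

lemma set_compositions:
  assumes "ks \<in> compositions m s"
  shows "set ks \<subseteq> {..s}"
  using assms by (auto simp: compositions_def intro: member_le_sum_list)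

lemma sum_split_weight:
  assumes "n \<ge> m - 1"
  shows "(\<Sum>k\<le>n. split_weight m n k * f k) =
    (\<Sum>ks\<in>compositions m (n - (m - 1)). \<Sum>k\<leftarrow>ks. f k) / (n choose (m - 1))"
proof -
  have "(\<Sum>k\<leftarrow>ks. f k) = (\<Sum>k\<le>n. real (count_list ks k) * f k)" if "ks \<in> compositions m (n - (m - 1))" for ks
    using set_compositions[OF that] by (intro sum_list_eq_sum_count_list) auto
  then have "(\<Sum>ks\<in>compositions m (n - (m - 1)). \<Sum>k\<leftarrow>ks. f k) =
      (\<Sum>k\<le>n. (\<Sum>ks\<in>compositions m (n - (m - 1)). real (count_list ks k)) * f k)"
    by (simp add: sum.swap[of _ "{..n}"] sum_distrib_right cong: sum.cong)
  then show ?thesis using assms by (simp add: split_weight_def sum_divide_distrib[of _ "{..n}"])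
qed

text \<open>The \<open>m\<close> parts of a composition sum to \<open>n - (m - 1)\<close>, so
  raising each by one gives total \<open>n + 1\<close>.\<close>

lemma split_weight_mass:
  assumes "m \<ge> 1"
  shows "(\<Sum>k\<le>n. split_weight m n k * real (k + 1)) = (if n < m - 1 then 0 else real (n + 1))"
proof (cases "n < m - 1")
  case True
  then show ?thesis by (simp add: split_weight_def)
next
  case False
  have "(\<Sum>k\<leftarrow>ks. real (k + 1)) = real (sum_list ks) + real (length ks)" for ks
    by (induction ks) auto
  then have "(\<Sum>ks\<in>compositions m (n - (m - 1)). \<Sum>k\<leftarrow>ks. real (k + 1)) =
      (\<Sum>ks\<in>compositions m (n - (m - 1)). real (n + 1))"
    using assms False by (intro sum.cong) (auto simp: compositions_def)
  also have "\<dots> = real (n choose (m - 1)) * real (n + 1)"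
    using card_compositions[of "m - 1" "n - (m - 1)"] assms False by simp
  finally show ?thesis using False by (subst sum_split_weight) auto
qed

text \<open>The factor \<open>(1 - z) ^ m\<close> cancels the \<open>m - 1\<close> geometric series
  and leaves \<open>m * z ^ k * (1 - z)\<close>, whose integral is \<open>m\<close> times the weight
  of \<open>k\<close>.\<close>

lemma split_weight_sums:
  assumes "m \<ge> 1"
  shows "(\<lambda>n. 1 / (real (n + 1) * real (n + 2)) * split_weight m n k) sums (1 / (real (k + 1) * real (k + 2)))"
proof -
  let ?N = "\<lambda>s. \<Sum>ks\<in>compositions m s. real (count_list ks k)"
  let ?f = "\<lambda>n. 1 / (real (n + 1) * real (n + 2)) * split_weight m n k"
  have "(\<lambda>s. ?N s * (fact s * fact m / fact (s + m + 1))) sums (real m * (fact k * fact 1 / fact (k + 1 + 1)))"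
  proof (rule sums_beta_weights)
    show "0 \<le> ?N s" for s by (simp add: sum_nonneg)
    show "(\<lambda>s. ?N s * (z ^ s * (1 - z) ^ m)) sums (real m * (z ^ k * (1 - z) ^ 1))" if "0 < z" "z < 1" for z
    proof -
      have "(1 / (1 - z)) ^ (m - 1) * (1 - z) ^ m = (1 / (1 - z) * (1 - z)) ^ (m - 1) * (1 - z)"
        using assms by (cases m) (simp_all only: power_mult_distrib power_Suc diff_Suc_1 mult_ac)
      then have "(1 / (1 - z)) ^ (m - 1) * (1 - z) ^ m = (1 - z) ^ 1" using that by simp
      then show ?thesis using sums_mult2[OF count_compositions_sums[of z k m], of "(1 - z) ^ m"] that
        by (simp only: mult.assoc less_imp_le)
    qed
    show "((\<lambda>z. real m * (z ^ k * (1 - z) ^ 1)) has_integral real m * (fact k * fact 1 / fact (k + 1 + 1))) {0..1}"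
      by (intro has_integral_mult_right has_integral_beta)
  qed
  then have "(\<lambda>s. ?N s * beta_weight s m / real m) sums (real m * beta_weight k 1 / real m)"
    unfolding beta_weight_def by (rule sums_divide)
  also have "(\<lambda>s. ?N s * beta_weight s m / real m) = (\<lambda>s. ?f (s + (m - 1)))"
  proof
    fix s
    have "?N s * beta_weight s m / real m = ?N s * (beta_weight s (Suc (m - 1)) / real (Suc (m - 1)))"
      using assms by simp
    also have "\<dots> = ?f (s + (m - 1))"
      unfolding beta_weight_binomial[symmetric] by (simp add: split_weight_def)
    finally show "?N s * beta_weight s m / real m = ?f (s + (m - 1))" .
  qed
  finally have "(\<lambda>s. ?f (s + (m - 1))) sums beta_weight k 1" using assms by simp
  \<comment> \<open>The shift loses nothing, since \<open>split_weight\<close> is zero for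
    \<open>n < m - 1\<close>.\<close>
  then have "?f sums beta_weight k 1"
    by (subst (asm) sums_zero_iff_shift) (auto simp: split_weight_def)
  then show ?thesis by (simp only: beta_weight_1)
qed

lemma mean_score_short:
  assumes "n < m - 1"
  shows "mean_score c m n = (if n = 0 then 0 else - c)"
proof -
  have "score c m xs = (if n = 0 then 0 else - c)" if "xs \<in> permutations_of_set (real ` {..<n})" for xs
  proof -
    have "set xs = real ` {..<n}" "distinct xs" using that by (auto dest: permutations_of_setD)
    then have "length xs = n" using distinct_card[of xs] by (simp add: card_image)
    then show ?thesis using assms by (auto simp: score_short)
  qed
  then show ?thesis by (simp add: mean_score_def perm_mean_def card_image)
qed

lemma sums_inverse_pronic: "(\<lambda>n. 1 / (real (n + 1) * real (n + 2))) sums 1"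
proof -
  have "(\<lambda>n. 1 / real (n + 1)) \<longlonglongrightarrow> 0" by real_asymp
  from telescope_sums'[OF this] have "(\<lambda>n. 1 / real (n + 1) - 1 / real (Suc n + 1)) sums 1" by simp
  also have "(\<lambda>n. 1 / real (n + 1) - 1 / real (Suc n + 1)) = (\<lambda>n. 1 / (real (n + 1) * real (n + 2)))"
    by (auto simp: field_simps)
  finally show ?thesis .
qed

text \<open>The vanishing weighted sum of the toll is solved for \<open>c\<close>. The range
  \<open>l < m\<close> omits the term \<open>(1 - z) ^ m\<close> of the binomial expansion, which
  belongs to the case that all children are empty.\<close>

lemma protected_limit_eq:
  assumes m: "m \<ge> 2"
    and lim: "(\<lambda>n. mean_score c m n / real (n + 1)) \<longlonglongrightarrow> 0"
  shows "c = 2 / real m * (\<Sum>l<m. real (m choose l) * beta_weight (m * (m - l)) l)"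
proof -
  define w where "w = (\<lambda>n. 1 / (real (n + 1) * real (n + 2)))"
  define r where "r = m - 1"
  have mr: "m = Suc r" using m by (simp add: r_def)
  \<comment> \<open>Below \<open>r\<close> there is no recursion, so the toll is the mean score
    itself.\<close>
  define b where "b = (\<lambda>n. if n < r then mean_score c m n
    else (\<Sum>ks\<in>compositions m (n - r). of_bool (protected_split m ks) - c) / (n choose r))"
  have rec: "mean_score c m n = b n + (\<Sum>k\<le>n. split_weight m n k * mean_score c m k)" for n
  proof (cases "n < r")
    case True
    then show ?thesis by (simp add: b_def split_weight_def r_def)
  next
    case False
    then show ?thesis using mean_score_rec[OF m, of n c] sum_split_weight[of m n "mean_score c m"]
      by (simp add: b_def r_def sum.distrib add_divide_distrib)
  qed
  have zero: "(\<lambda>n. w n * b n) sums 0"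
    unfolding w_def
  proof (rule weighted_toll_sums_zero[where a = "mean_score c m" and q = "split_weight m" and r = r])
    show "0 \<le> split_weight m n k" for n k by (simp add: split_weight_def sum_nonneg)
    show "split_weight m n k = 0" if "n < k" for n k
    proof -
      have "count_list ks k = 0" if "ks \<in> compositions m (n - (m - 1))" for ks
        using set_compositions[OF that] \<open>n < k\<close> by (intro count_notin) auto
      then show ?thesis by (simp add: split_weight_def)
    qed
    show "(\<Sum>k\<le>n. split_weight m n k * real (k + 1)) = (if n < r then 0 else real (n + 1))" for n
      unfolding r_def using m by (intro split_weight_mass) simp
    show "(\<lambda>n. 1 / (real (n + 1) * real (n + 2)) * split_weight m n k) sums (1 / (real (k + 1) * real (k + 2)))" for k
      using m by (intro split_weight_sums) simp
  qed (rule rec lim)+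

  define f where "f = (\<lambda>k. of_bool (k = 0 \<or> m \<le> k) :: real)"
  define g where "g = (\<lambda>s. \<Sum>ks\<in>compositions m s. \<Prod>k\<leftarrow>ks. f k)"
  define J where "J = (\<Sum>l\<le>m. real (m choose l) * beta_weight (m * (m - l)) l)"
  \<comment> \<open>For \<open>s = 0\<close> the composition into zeros passes the product test, but
    the root is then a leaf.\<close>
  have split: "of_bool (protected_split m ks) = (\<Prod>k\<leftarrow>ks. f k) - of_bool (s = 0)"
    if "ks \<in> compositions m s" for ks s
  proof -
    have "(\<Prod>k\<leftarrow>ks. f k) = of_bool (\<forall>k\<in>set ks. k = 0 \<or> m \<le> k)"
      by (induction ks) (auto simp: f_def)
    moreover have "s = 0 \<longleftrightarrow> (\<forall>k\<in>set ks. k = 0)" using that by (auto simp: compositions_def)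
    ultimately show ?thesis by (auto simp: protected_split_def)
  qed
  have "(\<lambda>s. g s * (fact s * fact m / fact (s + m + 1))) sums J"
  proof (rule sums_beta_weights)
    show "0 \<le> g s" for s unfolding g_def by (intro sum_nonneg prod_list_nonneg) (auto simp: f_def)
    show "(\<lambda>s. g s * (z ^ s * (1 - z) ^ m)) sums ((1 - z) + z ^ m) ^ m" if "0 < z" "z < 1" for z
    proof -
      have "(\<lambda>k. (if k = 0 then z ^ k else 0) + (if k < m then 0 else z ^ k)) sums (1 + z ^ m * (1 / (1 - z)))"
      proof (rule sums_add)
        show "(\<lambda>k. if k = 0 then z ^ k else 0) sums 1" using sums_single[of 0 "\<lambda>k. z ^ k"] by simp
        have "(\<lambda>k. z ^ m * z ^ k) sums (z ^ m * (1 / (1 - z)))"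
          using that by (intro sums_mult geometric_sums) auto
        then have "(\<lambda>k. if k + m < m then 0 else z ^ (k + m)) sums (z ^ m * (1 / (1 - z)))"
          by (simp add: power_add mult.commute)
        then show "(\<lambda>k. if k < m then 0 else z ^ k) sums (z ^ m * (1 / (1 - z)))"
          by (subst (asm) sums_zero_iff_shift) auto
      qed
      moreover have "(\<lambda>k. (if k = 0 then z ^ k else 0) + (if k < m then 0 else z ^ k)) = (\<lambda>k. f k * z ^ k)"
        using m by (auto simp: f_def)
      ultimately have "(\<lambda>k. f k * z ^ k) sums (1 + z ^ m * (1 / (1 - z)))" by simp
      then have "(\<lambda>s. g s * z ^ s) sums (1 + z ^ m * (1 / (1 - z))) ^ m"
        unfolding g_def using that by (intro prod_compositions_sums) (auto simp: f_def)
      from sums_mult2[OF this, of "(1 - z) ^ m"]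
      have "(\<lambda>s. g s * (z ^ s * (1 - z) ^ m)) sums ((1 + z ^ m * (1 / (1 - z))) * (1 - z)) ^ m"
        by (simp add: mult.assoc power_mult_distrib)
      also have "(1 + z ^ m * (1 / (1 - z))) * (1 - z) = (1 - z) + z ^ m"
        using that by (simp add: field_simps)
      finally show ?thesis .
    qed
    have "((\<lambda>z. \<Sum>l\<le>m. real (m choose l) * (z ^ (m * (m - l)) * (1 - z) ^ l)) has_integral J) {0..1}"
      unfolding J_def beta_weight_def by (intro has_integral_sum has_integral_mult_right has_integral_beta) auto
    also have "(\<lambda>z. \<Sum>l\<le>m. real (m choose l) * (z ^ (m * (m - l)) * (1 - z) ^ l)) = (\<lambda>z. ((1 - z) + z ^ m) ^ m)"
      unfolding binomial_ring by (simp add: power_mult mult_ac)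
    finally show "((\<lambda>z. ((1 - z) + z ^ m) ^ m) has_integral J) {0..1}" .
  qed
  then have "(\<lambda>s. g s * beta_weight s m - (if s = 0 then beta_weight s m else 0)) sums (J - beta_weight 0 m)"
    unfolding beta_weight_def[symmetric] by (intro sums_diff sums_single)
  then have "(\<lambda>s. (g s * beta_weight s m - (if s = 0 then beta_weight s m else 0)) / real m) sums
      ((J - beta_weight 0 m) / real m)"
    by (rule sums_divide)
  also have "(\<lambda>s. (g s * beta_weight s m - (if s = 0 then beta_weight s m else 0)) / real m) =
      (\<lambda>s. w (s + r) * (b (s + r) + c))"
  proof
    fix s
    have card: "card (compositions m s) = (s + r) choose r" by (simp add: mr card_compositions)
    have "(\<Sum>ks\<in>compositions m s. of_bool (protected_split m ks) - c) =
        (\<Sum>ks\<in>compositions m s. (\<Prod>k\<leftarrow>ks. f k) - of_bool (s = 0) - c)"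
      using split by (intro sum.cong) auto
    also have "\<dots> = g s - of_bool (s = 0) - c * real ((s + r) choose r)"
      using card by (cases "s = 0") (simp_all add: g_def sum_subtractf)
    finally have "b (s + r) + c = (g s - of_bool (s = 0)) / real ((s + r) choose r)"
      by (simp add: b_def field_simps)
    then have "w (s + r) * (b (s + r) + c) = (g s - of_bool (s = 0)) * (w (s + r) / real ((s + r) choose r))"
      by simp
    also have "w (s + r) / real ((s + r) choose r) = beta_weight s m / real m"
      unfolding w_def mr by (rule beta_weight_binomial)
    finally show "(g s * beta_weight s m - (if s = 0 then beta_weight s m else 0)) / real m = w (s + r) * (b (s + r) + c)"
      by (cases "s = 0") (simp_all add: algebra_simps diff_divide_distrib)
  qed
  finally have shifted: "(\<lambda>s. w (s + r) * (b (s + r) + c)) sums ((J - beta_weight 0 m) / real m)" .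
  have "(\<lambda>n. if n < r then 0 else w n * (b n + c)) sums ((J - beta_weight 0 m) / real m)"
    using shifted by (subst sums_zero_iff_shift[symmetric, of r]) auto
  \<comment> \<open>For \<open>n < r\<close> the term \<open>b n + c\<close> vanishes except at
    \<open>n = 0\<close>, where the score is \<open>0\<close> instead of \<open>- c\<close>. This
    exception accounts for the correction \<open>c * w 0\<close>.\<close>
  moreover have "(\<lambda>n. w n * b n + c * w n - (if n = 0 then c * w n else 0)) sums (0 + c * 1 - c * w 0)"
    using sums_inverse_pronic zero unfolding w_def[symmetric] by (intro sums_diff sums_add sums_mult sums_single)
  moreover have "(if n < r then 0 else w n * (b n + c)) = w n * b n + c * w n - (if n = 0 then c * w n else 0)" for n
    using m by (auto simp: b_def mean_score_short r_def algebra_simps)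
  \<comment> \<open>The left side is \<open>c / 2\<close>, as \<open>w 0 = 1 / 2\<close>; this is
    the source of the factor \<open>2\<close> in the formula.\<close>
  ultimately have "0 + c * 1 - c * w 0 = (J - beta_weight 0 m) / real m"
    by (simp only: sums_unique2)
  moreover have "w 0 = 1 / 2" by (simp add: w_def)
  ultimately have "c = 2 * ((J - beta_weight 0 m) / real m)" by simp
  moreover have "J - beta_weight 0 m = (\<Sum>l<m. real (m choose l) * beta_weight (m * (m - l)) l)"
    unfolding J_def lessThan_Suc_atMost[symmetric] by simp
  ultimately show ?thesis by simp
qed

section \<open>Asymptotics\<close>

lemma fact_add_Suc_prod:
  "fact (a + l + 1) = fact a * (\<Prod>i<l. real (a + 1 + i)) * real (a + l + 1)"
proof (induction l)
  case (Suc l)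
  have "fact (a + Suc l + 1) = real (a + Suc l + 1) * (fact (a + l + 1) :: real)" by simp
  then show ?case unfolding Suc by simp
qed simp

text \<open>Written with \<open>l\<close> separate quotients, so that each can be estimated on its
  own.\<close>

lemma binomial_beta_weight:
  "real (m choose l) * beta_weight a l =
    (\<Prod>i<l. (real m - real i) / real (a + 1 + i)) / real (a + l + 1)"
proof -
  have "real (m choose l) * fact l = (\<Prod>i<l. real m - real i)"
    by (simp add: binomial_gbinomial gbinomial_prod_rev atLeast0LessThan)
  then have "real (m choose l) * beta_weight a l = (\<Prod>i<l. real m - real i) * (fact a / fact (a + l + 1))"
    unfolding beta_weight_def by (simp add: mult_ac)
  also have "fact a / fact (a + l + 1) = 1 / ((\<Prod>i<l. real (a + 1 + i)) * real (a + l + 1))"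
    unfolding fact_add_Suc_prod by simp
  finally show ?thesis by (simp add: prod_dividef)
qed

text \<open>Here \<open>m * (m - l)\<close> is at least \<open>m ^ 2 / 2\<close>, so each quotient
  is at most \<open>2 / m\<close>.\<close>

lemma binomial_beta_weight_le_half:
  assumes "m \<ge> 1" "2 * l \<le> m"
  shows "real (m choose l) * beta_weight (m * (m - l)) l \<le> (2 / real m) ^ l * (2 / real m ^ 2)"
proof -
  define a where "a = m * (m - l)"
  have "2 * (m - l) \<ge> m" using assms by simp
  then have "m * m \<le> m * (2 * (m - l))" by (rule mult_le_mono2)
  then have "real (m * m) \<le> real (2 * a)" unfolding a_def by (simp only: of_nat_le_iff mult_ac)
  then have a: "real m ^ 2 / 2 \<le> real a" by (simp add: power2_eq_square)
  have "(real m - real i) / real (a + 1 + i) \<le> 2 / real m" for i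
  proof -
    have "(real m - real i) / real (a + 1 + i) \<le> real m / (real m ^ 2 / 2)"
      using a assms by (intro frac_le) auto
    also have "\<dots> = 2 / real m" by (simp add: power2_eq_square)
    finally show ?thesis .
  qed
  then have "(\<Prod>i<l. (real m - real i) / real (a + 1 + i)) \<le> (\<Prod>i<l. 2 / real m)"
    using assms by (intro prod_mono) auto
  moreover have "1 / real (a + l + 1) \<le> 1 / (real m ^ 2 / 2)"
    using a assms by (intro frac_le) auto
  ultimately have "(\<Prod>i<l. (real m - real i) / real (a + 1 + i)) * (1 / real (a + l + 1))
      \<le> (\<Prod>i<l. 2 / real m) * (1 / (real m ^ 2 / 2))"
    using assms by (intro mult_mono) (auto intro!: prod_nonneg)
  then show ?thesis using assms by (simp add: binomial_beta_weight a_def[symmetric])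
qed

text \<open>Here only \<open>m * (m - l) \<ge> m\<close> is available. The later half of the
  quotients, where \<open>i\<close> is about \<open>m / 4\<close> or more, are still at most
  \<open>(3 / 4) / (5 / 4) = 3 / 5\<close>.\<close>

lemma binomial_beta_weight_gt_half:
  assumes "m < 2 * l" "l < m"
  shows "real (m choose l) * beta_weight (m * (m - l)) l \<le> (3 / 5) ^ (m div 4)"
proof -
  define a where "a = m * (m - l)"
  have "m * 1 \<le> m * (m - l)" using assms by (intro mult_le_mono2) simp
  then have a: "m \<le> a" by (simp add: a_def)
  let ?x = "\<lambda>i. (real m - real i) / real (a + 1 + i)"
  have x1: "0 \<le> ?x i" "?x i \<le> 1" if "i < l" for i
    using that assms a by (auto simp: divide_le_eq_1)
  have x2: "?x i \<le> 3 / 5" if "i < l" "l div 2 \<le> i" for i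
  proof -
    have "m \<le> 4 * i + 1" using assms that by linarith
    then have "5 * (real m - real i) \<le> 3 * real (a + 1 + i)" using a by (simp add: algebra_simps)
    then show ?thesis by (simp add: divide_le_eq)
  qed
  have "(\<Prod>i<l. ?x i) = (\<Prod>i<l div 2. ?x i) * (\<Prod>i=l div 2..<l. ?x i)"
    using prod.atLeastLessThan_concat[of 0 "l div 2" l ?x] by (simp add: atLeast0LessThan)
  also have "\<dots> \<le> 1 * (\<Prod>i=l div 2..<l. 3 / 5)"
    using x1 x2 by (intro mult_mono prod_mono prod_le_1 prod_nonneg) auto
  also have "\<dots> = (3 / 5) ^ (l - l div 2)" by simp
  also have "\<dots> \<le> (3 / 5) ^ (m div 4)"
    using assms by (intro power_decreasing) auto
  finally have "(\<Prod>i<l. ?x i) \<le> (3 / 5) ^ (m div 4)" .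
  moreover have "(\<Prod>i<l. ?x i) / real (a + l + 1) \<le> (\<Prod>i<l. ?x i) / 1"
    using x1 by (intro divide_left_mono prod_nonneg) auto
  ultimately show ?thesis using assms by (simp add: binomial_beta_weight a_def[symmetric])
qed

lemma beta_weight_nonneg: "0 \<le> beta_weight s m"
  by (simp add: beta_weight_def)

text \<open>Each term is bounded by the sum of both estimates. Since
  \<open>2 / m \<le> 1 / 2\<close>, the first ones add up to at most a geometric series with leading
  term \<open>4 / m ^ 3\<close> and ratio \<open>1 / 2\<close>.\<close>

lemma sum_binomial_beta_weight_tail:
  assumes "m \<ge> 4"
  shows "(\<Sum>l=1..<m. real (m choose l) * beta_weight (m * (m - l)) l)
    \<le> 8 / real m ^ 3 + real m * (3 / 5) ^ (m div 4)"
proof -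
  let ?T = "\<lambda>l. real (m choose l) * beta_weight (m * (m - l)) l"
  have "?T l \<le> 4 / real m ^ 3 * (1 / 2) ^ (l - 1) + (3 / 5) ^ (m div 4)" if l: "1 \<le> l" "l < m" for l
  proof (cases "2 * l \<le> m")
    case True
    have "(2 / real m) ^ l = 2 / real m * (2 / real m) ^ (l - 1)" using l by (cases l) auto
    also have "\<dots> \<le> 2 / real m * (1 / 2) ^ (l - 1)"
      using assms by (intro mult_left_mono power_mono) (auto simp: field_simps)
    finally have "(2 / real m) ^ l * (2 / real m ^ 2) \<le> 2 / real m * (1 / 2) ^ (l - 1) * (2 / real m ^ 2)"
      by (intro mult_right_mono) auto
    also have "\<dots> = 4 / real m ^ 3 * (1 / 2) ^ (l - 1)"
      by (simp add: power2_eq_square power3_eq_cube)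
    finally have "?T l \<le> 4 / real m ^ 3 * (1 / 2) ^ (l - 1)"
      using binomial_beta_weight_le_half[of m l] True assms by simp
    then show ?thesis by (simp add: add_increasing2)
  next
    case False
    then have "?T l \<le> (3 / 5) ^ (m div 4)" using l by (intro binomial_beta_weight_gt_half) auto
    then show ?thesis by (simp add: add_increasing)
  qed
  then have "(\<Sum>l=1..<m. ?T l) \<le> (\<Sum>l=1..<m. 4 / real m ^ 3 * (1 / 2) ^ (l - 1) + (3 / 5) ^ (m div 4))"
    by (intro sum_mono) auto
  also have "\<dots> = 4 / real m ^ 3 * (\<Sum>l=1..<m. (1 / 2) ^ (l - 1)) + real (m - 1) * (3 / 5) ^ (m div 4)"
    by (simp add: sum.distrib sum_distrib_left)
  also have "(\<Sum>l=1..<m. (1 / 2) ^ (l - 1)) = (\<Sum>l<m - 1. (1 / 2) ^ l :: real)"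
    by (rule sum.reindex_bij_witness[of _ Suc "\<lambda>l. l - 1"]) auto
  also have "4 / real m ^ 3 * \<dots> + real (m - 1) * (3 / 5) ^ (m div 4) \<le>
      4 / real m ^ 3 * 2 + real m * (3 / 5) ^ (m div 4)"
    by (intro add_mono mult_left_mono mult_right_mono) (auto simp: sum_gp_strict)
  finally show ?thesis by simp
qed

text \<open>The term \<open>l = 0\<close> equals \<open>1 / (m ^ 2 + 1)\<close> and yields the main
  term; the remaining sum is of order \<open>m ^ (-3)\<close> before multiplication by
  \<open>2 / m\<close>.\<close>

lemma protected_limit_asymptotics:
  assumes "\<And>m. m \<ge> 2 \<Longrightarrow> P m = 2 / real m * (\<Sum>l<m. real (m choose l) * beta_weight (m * (m - l)) l)"
  shows "(\<lambda>m. P m - 2 / real m ^ 3) \<in> O(\<lambda>m. 1 / real m ^ 4)"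
proof (rule bigoI[of _ 20])
  \<comment> \<open>The exponent \<open>m / 4 - 1\<close> is a lower bound for
    \<open>m div 4\<close> without integer division, so it gives an upper bound for the power of
    \<open>3 / 5\<close>.\<close>
  have "eventually (\<lambda>m::nat. real m * (3 / 5) powr (real m / 4 - 1) \<le> 1 / real m ^ 3) at_top"
    by real_asymp
  then show "eventually (\<lambda>m. norm (P m - 2 / real m ^ 3) \<le> 20 * norm (1 / real m ^ 4)) at_top"
    using eventually_ge_at_top[of 4]
  proof eventually_elim
    case (elim m)
    let ?T = "\<lambda>l. real (m choose l) * beta_weight (m * (m - l)) l"
    define R where "R = (\<Sum>l=1..<m. ?T l)"
    have "(\<Sum>l<m. ?T l) = ?T 0 + R"
      using elim by (simp add: R_def lessThan_atLeast0 sum.atLeast_Suc_lessThan del: binomial_n_0)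
    also have "?T 0 = 1 / (real m ^ 2 + 1)" by (simp add: beta_weight_def power2_eq_square)
    finally have P: "P m = 2 / real m * (1 / (real m ^ 2 + 1) + R)" using assms[of m] elim by simp
    have "(3 / 5) ^ (m div 4) = (3 / 5 :: real) powr real (m div 4)" by (simp add: powr_realpow)
    also have "\<dots> \<le> (3 / 5) powr (real m / 4 - 1)"
    proof (rule powr_mono')
      have "m \<le> 4 * (m div 4) + 3" by linarith
      then show "real m / 4 - 1 \<le> real (m div 4)" by linarith
    qed auto
    finally have "real m * (3 / 5) ^ (m div 4) \<le> real m * (3 / 5) powr (real m / 4 - 1)"
      by (intro mult_left_mono) auto
    then have R: "R \<le> 9 / real m ^ 3"
      using sum_binomial_beta_weight_tail[OF elim(2)] elim(1) unfolding R_def by simp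
    have R0: "0 \<le> R" unfolding R_def by (intro sum_nonneg mult_nonneg_nonneg beta_weight_nonneg) auto
    have m: "real m > 0" using elim by simp
    have "1 / real m ^ 2 - 1 / (real m ^ 2 + 1) = 1 / (real m ^ 2 * (real m ^ 2 + 1))"
    proof -
      have "1 / q - 1 / (q + 1) = 1 / (q * (q + 1))" if "q > 0" for q :: real
        using that by (simp add: field_simps)
      then show ?thesis using m by simp
    qed
    also have "\<dots> \<le> 1 / real m ^ 3"
    proof (rule frac_le)
      have "real m ^ 3 \<le> real m ^ 4" using elim by (intro power_increasing) auto
      also have "\<dots> \<le> real m ^ 2 * (real m ^ 2 + 1)" by (simp add: power2_eq_square power4_eq_xxxx algebra_simps)
      finally show "real m ^ 3 \<le> real m ^ 2 * (real m ^ 2 + 1)" .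
    qed (use m in auto)
    finally have lower: "1 / real m ^ 2 - 1 / (real m ^ 2 + 1) \<le> 1 / real m ^ 3" .
    have upper: "1 / (real m ^ 2 + 1) \<le> 1 / real m ^ 2" using m by (intro frac_le) auto
    \<comment> \<open>The \<open>10\<close> consists of \<open>8 + 1\<close> from the bound on
      \<open>R\<close> and \<open>1\<close> from replacing \<open>m ^ 2 + 1\<close> by
      \<open>m ^ 2\<close>; the factor \<open>2 / m\<close> then gives the constant
      \<open>20\<close>.\<close>
    have inner: "\<bar>1 / (real m ^ 2 + 1) + R - 1 / real m ^ 2\<bar> \<le> 10 / real m ^ 3"
      using lower upper R R0 by (simp add: abs_le_iff)
    have "P m - 2 / real m ^ 3 = 2 / real m * (1 / (real m ^ 2 + 1) + R - 1 / real m ^ 2)"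
      unfolding P by (simp add: algebra_simps power2_eq_square power3_eq_cube)
    then have "norm (P m - 2 / real m ^ 3) = 2 / real m * \<bar>1 / (real m ^ 2 + 1) + R - 1 / real m ^ 2\<bar>"
      by (simp only: real_norm_def abs_mult) simp
    also have "\<dots> \<le> 2 / real m * (10 / real m ^ 3)" using inner by (intro mult_left_mono) auto
    also have "\<dots> = 20 * norm (1 / real m ^ 4)" by (simp add: power3_eq_cube power4_eq_xxxx)
    finally show ?case .
  qed
qed

text \<open>The closed form of \<open>P2 m\<close> is derived from the almost sure convergence and
  not assumed.\<close>

theorem theorem10p5:
  fixes M :: "'a measure" and X :: "nat \<Rightarrow> 'a \<Rightarrow> real" and P2 :: "nat \<Rightarrow> real"
  assumes "prob_space M"
    and "prob_space.indep_vars M (\<lambda>_. borel) X UNIV"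
    and "\<And>i. distr M borel (X i) = distr M borel (X 0)"
    and "continuous_on UNIV (cdf (distr M borel (X 0)))"
    and "\<And>m. m \<ge> 2 \<Longrightarrow>
      AE \<omega> in M. (\<lambda>n. protected_fraction (search_tree m (map (\<lambda>i. X i \<omega>) [0..<n])))
        \<longlonglongrightarrow> P2 m"
  shows "(\<lambda>m. P2 m - 2 / real m ^ 3) \<in> O(\<lambda>m. 1 / real m ^ 4)"
proof (rule protected_limit_asymptotics)
  fix m :: nat assume "m \<ge> 2"
  then show "P2 m = 2 / real m * (\<Sum>l<m. real (m choose l) * beta_weight (m * (m - l)) l)"
    using assms by (intro protected_limit_eq prob_space.mean_score_sublinear[of M X])
qed

end
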